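(* Let \(\lambda\) be a Salem number and let \(S(t)\in\mathbb{Z}[t]\) be its minimal polynomial. \begin{enumerate} \item If \(\lambda\) has degree six, then \(\log(\lambda)\) is the topological entropy of some automorphism of a two-dimensional complex torus if and only if \(S(1)=-m^2\) for some integer \(m\) and \(S(-1)=n^2\) for some integer \(n\). \item If \(\lambda\) has degree four, then \(\log(\lambda)\) is the topological entropy of some automorphism of a two-dimensional complex torus if and only if one of the following three cases holds: (a) \(S(1)=-m^2\) for some integer \(m\); (b) \(S(-1)=n^2\) for some integer \(n\); or (c) \(S(1)=-\frac{1}{2}m^2\) and \(S(-1)=\frac{1}{2}n^2\) for some integers \(m\) and \(n\). \item If \(\lambda\) has degree two, then \(\log(\lambda)\) is the topological entropy of some automorphism of a two-dimensional complex torus. \end{enumerate} Moreover, these cases constitute all possible positive entropies of automorphisms of two-dimensional complex tori: if \(F\) is an automorphism of a two-dimensional complex torus with positive topological entropy \(h(F)\), then \(h(F)=\log(\lambda)\) for some Salem number \(\lambda\) of degree two, four, or six.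
   Context: A Salem number is a real algebraic integer \(\lambda>1\) whose minimal polynomial over \(\mathbb{Z}\) is reciprocal (i.e. \(t^{d}S(1/t)=S(t)\), \(d=\deg S\)) and has exactly two roots off the unit circle, namely \(\lambda\) and \(\lambda^{-1}\); in this paper Salem numbers of degree two (roots \(>1\) of \(t^2-at+1\), \(a>2\) an integer) are allowed. The degree of \(\lambda\) is the degree of its minimal polynomial. A two-dimensional complex torus is \(X=\mathbb{C}^2/\Lambda\) with \(\Lambda\subseteq\mathbb{C}^2\) a lattice of rank four; an automorphism of \(X\) is a biholomorphic self-map of \(X\). Entropy means topological entropy. *)

theory Defs
  imports "HOL-Analysis.Analysis" "HOL-Computational_Algebra.Polynomial"
    "HOL-Library.Numeral_Type"
begin

definition min_poly_Z :: "real \<Rightarrow> int poly \<Rightarrow> bool" where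
  "min_poly_Z lam S \<longleftrightarrow> lead_coeff S = 1 \<and> irreducible S \<and>
     poly (map_poly real_of_int S) lam = 0"

definition salem :: "real \<Rightarrow> int poly \<Rightarrow> bool" where
  "salem lam S \<longleftrightarrow> lam > 1 \<and> min_poly_Z lam S \<and> reflect_poly S = S \<and>
     {z :: complex. poly (map_poly complex_of_int S) z = 0 \<and> cmod z \<noteq> 1}
       = {complex_of_real lam, complex_of_real (1 / lam)}"

definition lattice4 :: "(complex ^ 2) set \<Rightarrow> bool" where
  "lattice4 L \<longleftrightarrow> (\<exists>v :: 4 \<Rightarrow> complex ^ 2. inj v \<and> independent (range v) \<and>
      L = {(\<Sum>i\<in>UNIV. real_of_int (n i) *\<^sub>R v i) | n :: 4 \<Rightarrow> int. True})"

definition holo2 :: "(complex ^ 2 \<Rightarrow> complex ^ 2) \<Rightarrow> bool" where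
  "holo2 f \<longleftrightarrow> (\<forall>z. \<exists>D. (f has_derivative D) (at z) \<and>
      (\<forall>c w. D (c *s w) = c *s D w))"

definition descends :: "(complex ^ 2) set \<Rightarrow> (complex ^ 2 \<Rightarrow> complex ^ 2) \<Rightarrow> bool" where
  "descends L f \<longleftrightarrow> (\<forall>z l. l \<in> L \<longrightarrow> f (z + l) - f z \<in> L)"

text \<open>An automorphism (biholomorphic self-map) of X = C^2 / L, represented by a
  holomorphic lift f : C^2 \<rightarrow> C^2 (every holomorphic self-map of X lifts to the
  universal cover C^2); its inverse is represented by a lift g.\<close>
definition torus_aut :: "(complex ^ 2) set \<Rightarrow> (complex ^ 2 \<Rightarrow> complex ^ 2) \<Rightarrow> bool" where
  "torus_aut L f \<longleftrightarrow> descends L f \<and> holo2 f \<and>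
     (\<exists>g. descends L g \<and> holo2 g \<and> (\<forall>z. g (f z) - z \<in> L) \<and> (\<forall>z. f (g z) - z \<in> L))"

definition tdist :: "(complex ^ 2) set \<Rightarrow> complex ^ 2 \<Rightarrow> complex ^ 2 \<Rightarrow> real" where
  "tdist L x y = Inf {norm (x - y - l) | l. l \<in> L}"

text \<open>(n, eps)-separated sets (points at distance 0 in X, i.e. equal mod L, are
  never separated, so such sets are sets of distinct points of X).\<close>
definition separated :: "(complex ^ 2) set \<Rightarrow> (complex ^ 2 \<Rightarrow> complex ^ 2) \<Rightarrow> nat \<Rightarrow> real
    \<Rightarrow> (complex ^ 2) set \<Rightarrow> bool" where
  "separated L f n eps E \<longleftrightarrow> (\<forall>x\<in>E. \<forall>y\<in>E. x \<noteq> y \<longrightarrow>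
      (\<exists>k<n. tdist L ((f ^^ k) x) ((f ^^ k) y) > eps))"

definition max_sep :: "(complex ^ 2) set \<Rightarrow> (complex ^ 2 \<Rightarrow> complex ^ 2) \<Rightarrow> nat \<Rightarrow> real \<Rightarrow> real" where
  "max_sep L f n eps = Sup {real (card E) | E. finite E \<and> separated L f n eps E}"

definition top_entropy :: "(complex ^ 2) set \<Rightarrow> (complex ^ 2 \<Rightarrow> complex ^ 2) \<Rightarrow> ereal" where
  "top_entropy L f = (SUP eps\<in>{0<..}. limsup (\<lambda>n. ereal (ln (max_sep L f n eps) / real n)))"

definition torus_entropy_value :: "real \<Rightarrow> bool" where
  "torus_entropy_value h \<longleftrightarrow>
     (\<exists>L f. lattice4 L \<and> torus_aut L f \<and> top_entropy L f = ereal h)"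

end

theory Submission
  imports Defs "HOL-Complex_Analysis.Complex_Analysis"
    "HOL-Computational_Algebra.Fundamental_Theorem_Algebra"
    "HOL-Real_Asymp.Real_Asymp"
begin

text \<open>
  By Liouville's theorem an automorphism of a torus lifts to an affine map \<open>z \<mapsto> A z + b\<close> with
  \<open>A L = L\<close>. If \<open>\<alpha>, \<beta>\<close> are the eigenvalues of \<open>A\<close>, then \<open>|\<alpha> \<beta>| = 1\<close>, the characteristic
  polynomial of \<open>A\<close> on \<open>L\<close> is an integer quartic \<open>x^4 - a x^3 + b x^2 - c x + 1\<close> with roots \<open>\<alpha>, \<beta>\<close>
  and their conjugates, and for \<open>|\<alpha>| \<ge> |\<beta>|\<close> the entropy is \<open>ln lam\<close> with \<open>lam = |\<alpha>|^2\<close>. The number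
  \<open>lam\<close> is a root of the characteristic polynomial \<open>Q\<close> of the second exterior power, whose other
  roots are \<open>1 / lam\<close> and four numbers of modulus 1. As \<open>Q(1) = -(a - c)^2\<close> and
  \<open>Q(-1) = (a + c)^2\<close>, and as \<open>Q\<close> is the minimal polynomial \<open>S\<close> times a reciprocal factor with all
  roots on the unit circle, the conditions on \<open>S(1)\<close> and \<open>S(-1)\<close> are necessary.

  Conversely, write \<open>Q(x) = x^3 T(x + 1 / x)\<close> with \<open>T\<close> having the roots \<open>lam + 1 / lam, t2, t3\<close>. The
  conditions allow one to solve for integers \<open>a, b, c\<close> with distinct \<open>t2, t3\<close> in \<open>[-2, 2]\<close>. The
  quartic then has no real roots, and \<open>diag(\<alpha>, \<beta>)\<close> acts on the lattice spanned by the vectors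
  \<open>(\<alpha>^i, \<beta>^i)\<close>, \<open>i < 4\<close>.
\<close>

section \<open>Integer polynomials and Salem numbers\<close>

text \<open>The squares come from the resolvent cubic. Its roots are the sums
  \<open>x1 x2 + x3 x4\<close> over the three pairings of the roots of the quartic, and it is the
  \<open>T\<close> of the overview. In degree six \<open>S\<close> determines \<open>T\<close>, so
  both conditions are forced. In degree four the remaining root of \<open>T\<close> is an integer in
  \<open>[-2, 2]\<close>, and its five values account for the three cases; 1 and -1 add no new
  condition, so the converse uses -2, 0 and 2 only. The delicate point of the converse is that the
  roots of the quartic must be nonreal, so that they form conjugate pairs and the four vectors are
  independent over the reals. The bound on \<open>t2\<close> and \<open>t3\<close> alone leaves a
  degenerate case open; their distinctness, which for degrees four and six comes from the
  irreducibility of \<open>S\<close>, excludes it. On the dynamical side a nontrivial Jordan block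
  occurs only when all eigenvalues have modulus 1. There it costs a polynomial factor, which the
  logarithm discards, so diagonalizable and other maps are treated alike.\<close>

abbreviation ipoly :: "int poly \<Rightarrow> 'a::comm_ring_1 \<Rightarrow> 'a" where
  "ipoly p z \<equiv> poly (map_poly of_int p) z"

lemma map_poly_of_int_add: "map_poly of_int (p + q) = map_poly of_int p + map_poly of_int q"
  by (rule poly_eqI) (simp add: coeff_map_poly)

lemma map_poly_of_int_mult: "map_poly of_int (p * q) = map_poly of_int p * map_poly of_int q"
  by (rule poly_eqI) (simp add: coeff_map_poly coeff_mult)

lemma map_poly_of_int_smult: "map_poly of_int (smult c p) = smult (of_int c) (map_poly of_int p)"
  by (rule poly_eqI) (simp add: coeff_map_poly)

lemma map_poly_of_int_pderiv:
  "map_poly of_int (pderiv p) = (pderiv (map_poly of_int p) :: 'a::idom poly)"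
  by (rule poly_eqI) (simp add: coeff_map_poly coeff_pderiv)

lemma map_poly_of_int_eq_0 [simp]:
  "map_poly of_int p = (0 :: 'a::ring_char_0 poly) \<longleftrightarrow> p = 0"
  by (rule map_poly_eq_0_iff) auto

lemma degree_map_poly_of_int [simp]:
  "degree (map_poly (of_int :: int \<Rightarrow> 'a::ring_char_0) p) = degree p"
  by (rule degree_map_poly) simp

section \<open>Minimal polynomials over the integers\<close>

lemma ipoly_dvd:
  assumes "p dvd q" "ipoly p z = 0"
  shows "ipoly q z = 0"
  using assms by (auto elim!: dvdE simp: map_poly_of_int_mult)

text \<open>Over the integers only pseudo-division is available, and it multiplies \<open>R\<close>
  by a constant \<open>a\<close>. For the primitive part of an annihilator of least degree,
  comparing contents (Gauss's lemma) cancels \<open>a\<close> again.\<close>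

lemma exists_minimal_int_poly:
  fixes z :: "'a::{idom,ring_char_0}"
  assumes "Q \<noteq> 0" "ipoly Q z = 0"
  obtains M where "irreducible M" "ipoly M z = 0" "\<And>R. ipoly R z = 0 \<Longrightarrow> M dvd R"
proof -
  define N where "N = arg_min degree (\<lambda>R. R \<noteq> 0 \<and> ipoly R z = 0)"
  have N: "N \<noteq> 0" "ipoly N z = 0"
    and N_min: "\<And>R. R \<noteq> 0 \<Longrightarrow> ipoly R z = 0 \<Longrightarrow> degree N \<le> degree R"
    using arg_min_nat_lemma[of "\<lambda>R. R \<noteq> 0 \<and> ipoly R z = 0" Q degree] assms
    unfolding N_def by auto
  define M where "M = primitive_part N"
  have NM: "N = smult (content N) M"
    unfolding M_def by simp
  have content_M: "content M = 1"
    unfolding M_def using N(1) by simp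
  have M0: "M \<noteq> 0" using content_M by auto
  have "of_int (content N) * ipoly M z = 0"
    using N(2) by (subst (asm) NM) (simp add: map_poly_of_int_smult)
  then have M_root: "ipoly M z = 0"
    using N(1) by simp
  have deg_M: "degree M = degree N"
    unfolding M_def by simp
  have dvd: "M dvd R" if R: "ipoly R z = 0" for R
  proof -
    obtain a q where aq: "a \<noteq> 0" "smult a R = M * q + pseudo_mod R M"
      and small: "pseudo_mod R M = 0 \<or> degree (pseudo_mod R M) < degree M"
      using pseudo_mod[OF M0, of R] by blast
    have "ipoly (smult a R) z = 0"
      by (simp add: map_poly_of_int_smult R)
    then have "ipoly (pseudo_mod R M) z = 0"
      unfolding aq(2) by (simp add: map_poly_of_int_add map_poly_of_int_mult M_root)
    then have "pseudo_mod R M = 0"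
      using N_min[of "pseudo_mod R M"] small deg_M by linarith
    then have eq: "smult a R = M * q"
      using aq(2) by simp
    have "content q = content (M * q)"
      by (simp add: content_mult content_M)
    also have "\<dots> = content (smult a R)"
      by (simp add: eq)
    finally have "a dvd content q"
      by simp
    then obtain q' where "q = [:a:] * q'"
      by (metis const_poly_dvd_iff_dvd_content dvdE)
    then have "smult a R = smult a (M * q')"
      using eq by simp
    then have "smult a (R - M * q') = 0"
      by (simp add: smult_diff_right)
    then have "R = M * q'"
      using aq(1) by simp
    then show ?thesis by simp
  qed
  have deg_pos: "degree M \<noteq> 0"
  proof
    assume "degree M = 0"
    then obtain c where "M = [:c:]" by (auto elim: degree_eq_zeroE)
    then show False using M_root M0 by (simp add: map_poly_pCons)
  qed
  \<comment> \<open>The factor that keeps the root already has full degree, so the other one is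
    constant, and primitivity of \<open>M\<close> makes it a unit.\<close>
  have unit: "g dvd 1" if "M = f * g" "ipoly f z = 0" for f g
  proof -
    have "f \<noteq> 0" "g \<noteq> 0" using that M0 by auto
    then have "degree M \<le> degree f" using N_min[of f] that deg_M by simp
    then have "degree g = 0" using \<open>f \<noteq> 0\<close> \<open>g \<noteq> 0\<close> that(1) by (simp add: degree_mult_eq)
    then obtain c where c: "g = [:c:]" by (auto elim: degree_eq_zeroE)
    have "g dvd M" unfolding that(1) by (rule dvd_triv_right)
    then have "c dvd 1" unfolding c const_poly_dvd_iff_dvd_content content_M .
    then show ?thesis by (simp add: c is_unit_const_poly_iff)
  qed
  have "irreducible M"
  proof (rule irreducibleI)
    show "M \<noteq> 0" by (rule M0)
    show "\<not> M dvd 1" using deg_pos by (auto simp: is_unit_poly_iff)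
    show "a dvd 1 \<or> b dvd 1" if "M = a * b" for a b
    proof -
      have "ipoly a z = 0 \<or> ipoly b z = 0"
        using M_root that by (simp add: map_poly_of_int_mult)
      then show ?thesis using unit[of a b] unit[of b a] that by (auto simp: mult.commute)
    qed
  qed
  then show ?thesis using that M_root dvd by blast
qed

lemma irreducible_imp_dvd:
  fixes z :: "'a::{idom,ring_char_0}"
  assumes "irreducible S" "ipoly S z = 0" "ipoly R z = 0"
  shows "S dvd R"
proof -
  have "S \<noteq> 0" using assms(1) by auto
  then obtain M where M: "irreducible M" "ipoly M z = 0" "\<And>R. ipoly R z = 0 \<Longrightarrow> M dvd R"
    using exists_minimal_int_poly assms(2) by blast
  then have "M dvd S" using assms(2) by blast
  then have "S dvd M \<or> is_unit M" by (rule irreducibleD'[OF assms(1)])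
  then have "S dvd M" using irreducible_not_unit[OF M(1)] by blast
  also have "M dvd R" using M(3) assms(3) by blast
  finally show ?thesis .
qed

lemma irreducible_root_degree:
  fixes z :: "'a::{idom,ring_char_0}"
  assumes "irreducible S" "ipoly S z = 0" "ipoly R z = 0" "R \<noteq> 0"
  shows "degree S \<le> degree R"
  using irreducible_imp_dvd[OF assms(1-3)] assms(4) by (rule dvd_imp_degree_le)

text \<open>A root of a squared factor is also a root of the derivative, whose degree is too small.
  The factors may live over a larger field; this later keeps the traces \<open>z + 1 / z\<close> of
  a Salem polynomial distinct.\<close>

lemma irreducible_separable:
  fixes z :: "'a::{field_char_0}"
  assumes "irreducible S" "map_poly of_int S = g * g * h" "poly g z = 0"
  shows False
proof -
  have root: "ipoly S z = 0"
    using assms by simp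
  have "ipoly (pderiv S) z = 0"
    using assms by (simp add: map_poly_of_int_pderiv pderiv_mult)
  moreover have deg: "degree S \<noteq> 0"
  proof
    assume "degree S = 0"
    then obtain c where "S = [:c:]" by (auto elim: degree_eq_zeroE)
    then show False using root assms(1) by (auto simp: map_poly_pCons)
  qed
  ultimately have "degree S \<le> degree (pderiv S)"
    using irreducible_root_degree[OF assms(1) root] by (auto simp: pderiv_eq_0_iff)
  then show False using deg by (simp add: degree_pderiv)
qed

section \<open>Palindromic polynomials\<close>

lemma palindrome_degree_2:
  fixes S :: "int poly"
  assumes "reflect_poly S = S" "lead_coeff S = 1" "degree S = 2"
  obtains b where "S = [:1, b, 1:]"
proof
  have sym: "coeff S k = coeff S (2 - k)" if "k \<le> 2" for k
    using that coeff_reflect_poly[of S k] unfolding assms(1,3) by simp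
  have top: "coeff S 2 = 1"
    using assms(2,3) by simp
  have zero: "coeff S n = 0" if "n > 2" for n
    using that assms(3) by (simp add: coeff_eq_0)
  show "S = [:1, coeff S 1, 1:]"
  proof (rule poly_eqI)
    fix n :: nat
    consider "n = 0" | "n = 1" | "n = 2" | "n > 2" by linarith
    then show "coeff S n = coeff [:1, coeff S 1, 1:] n"
      using sym[of 0] top zero[of n]
      by cases (simp_all add: coeff_pCons eval_nat_numeral split: nat.split)
  qed
qed

lemma palindrome_degree_4:
  fixes S :: "int poly"
  assumes "reflect_poly S = S" "lead_coeff S = 1" "degree S = 4"
  obtains b s where "S = [:1, b, s, b, 1:]"
proof
  have sym: "coeff S k = coeff S (4 - k)" if "k \<le> 4" for k
    using that coeff_reflect_poly[of S k] unfolding assms(1,3) by simp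
  have top: "coeff S 4 = 1"
    using assms(2,3) by simp
  have zero: "coeff S n = 0" if "n > 4" for n
    using that assms(3) by (simp add: coeff_eq_0)
  show "S = [:1, coeff S 1, coeff S 2, coeff S 1, 1:]"
  proof (rule poly_eqI)
    fix n :: nat
    consider "n = 0" | "n = 1" | "n = 2" | "n = 3" | "n = 4" | "n > 4" by linarith
    then show "coeff S n = coeff [:1, coeff S 1, coeff S 2, coeff S 1, 1:] n"
      using sym[of 0] sym[of 1] top zero[of n]
      by cases (simp_all add: coeff_pCons eval_nat_numeral split: nat.split)
  qed
qed

lemma palindrome_degree_6:
  fixes S :: "int poly"
  assumes "reflect_poly S = S" "lead_coeff S = 1" "degree S = 6"
  obtains b s k where "S = [:1, b, s, k, s, b, 1:]"
proof
  have sym: "coeff S k = coeff S (6 - k)" if "k \<le> 6" for k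
    using that coeff_reflect_poly[of S k] unfolding assms(1,3) by simp
  have top: "coeff S 6 = 1"
    using assms(2,3) by simp
  have zero: "coeff S n = 0" if "n > 6" for n
    using that assms(3) by (simp add: coeff_eq_0)
  show "S = [:1, coeff S 1, coeff S 2, coeff S 3, coeff S 2, coeff S 1, 1:]"
  proof (rule poly_eqI)
    fix n :: nat
    consider "n = 0" | "n = 1" | "n = 2" | "n = 3" | "n = 4" | "n = 5" | "n = 6" | "n > 6" by linarith
    then show "coeff S n = coeff [:1, coeff S 1, coeff S 2, coeff S 3, coeff S 2, coeff S 1, 1:] n"
      using sym[of 0] sym[of 1] sym[of 2] top zero[of n]
      by cases (simp_all add: coeff_pCons eval_nat_numeral split: nat.split)
  qed
qed

text \<open>This is \<open>x^3 T(x + 1 / x)\<close> for the resolvent cubic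
  \<open>T(y) = y^3 - b y^2 + (a c - 4) y - (a^2 + c^2 - 4 b)\<close> of
  \<open>x^4 - a x^3 + b x^2 - c x + 1\<close>.\<close>

definition ext_sq_poly :: "int \<Rightarrow> int \<Rightarrow> int \<Rightarrow> int poly" where
  "ext_sq_poly a b c =
     [:1, - b, a * c - 1, 2 * b - a\<^sup>2 - c\<^sup>2, a * c - 1, - b, 1:]"

lemma poly_ext_sq_poly_1: "poly (ext_sq_poly a b c) 1 = - ((a - c)\<^sup>2)"
  by (simp add: ext_sq_poly_def algebra_simps power2_eq_square)

lemma poly_ext_sq_poly_minus_1: "poly (ext_sq_poly a b c) (-1) = (a + c)\<^sup>2"
  by (simp add: ext_sq_poly_def algebra_simps power2_eq_square)

lemma degree_ext_sq_poly: "degree (ext_sq_poly a b c) = 6"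
  by (simp add: ext_sq_poly_def)

text \<open>Complementary products such as \<open>x1 * x2\<close> and \<open>x3 * x4\<close> are
  inverse to each other, so each pairing contributes a factor \<open>z^2 - y z + 1\<close>. The
  facts \<open>b\<close>, \<open>ac\<close> and \<open>k\<close> are Vieta's relations for
  \<open>y1, y2, y3\<close>.\<close>

lemma ipoly_ext_sq_poly:
  fixes x1 x2 x3 x4 z :: complex
  assumes "of_int a = x1 + x2 + x3 + x4"
    and "of_int b = x1 * x2 + x1 * x3 + x1 * x4 + x2 * x3 + x2 * x4 + x3 * x4"
    and "of_int c = x1 * x2 * x3 + x1 * x2 * x4 + x1 * x3 * x4 + x2 * x3 * x4"
    and e4: "x1 * x2 * x3 * x4 = 1"
  shows "ipoly (ext_sq_poly a b c) z = (z - x1 * x2) * (z - x3 * x4) *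
    ((z - x1 * x3) * (z - x2 * x4)) * ((z - x1 * x4) * (z - x2 * x3))"
proof -
  define y1 where "y1 = x1 * x2 + x3 * x4"
  define y2 where "y2 = x1 * x3 + x2 * x4"
  define y3 where "y3 = x1 * x4 + x2 * x3"
  have fact: "(z - x1 * x2) * (z - x3 * x4) = z\<^sup>2 - y1 * z + 1"
    "(z - x1 * x3) * (z - x2 * x4) = z\<^sup>2 - y2 * z + 1"
    "(z - x1 * x4) * (z - x2 * x3) = z\<^sup>2 - y3 * z + 1"
  proof -
    have "(z - x1 * x2) * (z - x3 * x4) = z\<^sup>2 - y1 * z + x1 * x2 * x3 * x4"
      "(z - x1 * x3) * (z - x2 * x4) = z\<^sup>2 - y2 * z + x1 * x2 * x3 * x4"
      "(z - x1 * x4) * (z - x2 * x3) = z\<^sup>2 - y3 * z + x1 * x2 * x3 * x4"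
      unfolding y1_def y2_def y3_def by algebra+
    then show "(z - x1 * x2) * (z - x3 * x4) = z\<^sup>2 - y1 * z + 1"
      "(z - x1 * x3) * (z - x2 * x4) = z\<^sup>2 - y2 * z + 1"
      "(z - x1 * x4) * (z - x2 * x3) = z\<^sup>2 - y3 * z + 1"
      unfolding e4 by simp_all
  qed
  have b: "of_int b = y1 + y2 + y3"
    unfolding assms(2) y1_def y2_def y3_def by simp
  have ac: "of_int (a * c - 1) = y1 * y2 + y1 * y3 + y2 * y3 + 3"
  proof -
    \<comment> \<open>The product of the roots is kept as a factor, which makes this an identity of
      polynomials in \<open>x1, ..., x4\<close>; only afterwards is it replaced by 1.\<close>
    have "of_int (a * c) = y1 * y2 + y1 * y3 + y2 * y3 + 4 * (x1 * x2 * x3 * x4)"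
      unfolding of_int_mult assms(1,3) y1_def y2_def y3_def by algebra
    then show ?thesis unfolding e4 by simp
  qed
  have k: "of_int (2 * b - a\<^sup>2 - c\<^sup>2) = - (y1 * y2 * y3) - 2 * (y1 + y2 + y3)"
  proof -
    have "y1 * y2 * y3 = of_int (c\<^sup>2) + (x1 * x2 * x3 * x4) * of_int (a\<^sup>2)
        - 4 * (x1 * x2 * x3 * x4) * of_int b"
      unfolding of_int_power assms(1-3)
      unfolding y1_def y2_def y3_def by algebra
    then show ?thesis unfolding e4 using b by simp
  qed
  have "ipoly (ext_sq_poly a b c) z = 1 + z * (- of_int b + z * (of_int (a * c - 1) +
      z * (of_int (2 * b - a\<^sup>2 - c\<^sup>2) + z * (of_int (a * c - 1) + z * (- of_int b + z)))))"
    by (simp add: ext_sq_poly_def map_poly_pCons)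
  also have "\<dots> = (z\<^sup>2 - y1 * z + 1) * (z\<^sup>2 - y2 * z + 1) * (z\<^sup>2 - y3 * z + 1)"
    unfolding ac k b by algebra
  finally show ?thesis unfolding fact .
qed

lemma salemD:
  assumes "salem lam S"
  shows "lam > 1" "lead_coeff S = 1" "irreducible S" "ipoly S lam = 0" "reflect_poly S = S"
    "{z :: complex. ipoly S z = 0 \<and> cmod z \<noteq> 1} = {complex_of_real lam, complex_of_real (1 / lam)}"
  using assms by (simp_all only: salem_def min_poly_Z_def)

lemma salem_root_complex:
  assumes "salem lam S"
  shows "ipoly S (complex_of_real lam) = 0" "ipoly S (complex_of_real (1 / lam)) = 0"
proof -
  have "complex_of_real lam \<in> {z. ipoly S z = 0 \<and> cmod z \<noteq> 1}"
    "complex_of_real (1 / lam) \<in> {z. ipoly S z = 0 \<and> cmod z \<noteq> 1}"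
    unfolding salemD(6)[OF assms] by simp_all
  then show "ipoly S (complex_of_real lam) = 0" "ipoly S (complex_of_real (1 / lam)) = 0"
    by simp_all
qed

lemma ipoly_of_real: "ipoly S (complex_of_real x) = complex_of_real (ipoly S x)"
  by (induction S) (auto simp: map_poly_pCons)

lemma ipoly_of_int: "ipoly S (of_int x :: 'a::comm_ring_1) = of_int (poly S x)"
  by (induction S) (auto simp: map_poly_pCons)

lemma salem_dvd:
  assumes "salem lam S" "ipoly R lam = 0"
  shows "S dvd R"
  using irreducible_imp_dvd[OF salemD(3,4)[OF assms(1)] assms(2)] .

lemma salem_entropy_degree_6:
  assumes "salem lam S" "degree S = 6" "ipoly (ext_sq_poly a b c) lam = 0"
  shows "S = ext_sq_poly a b c"
proof -
  obtain R where R: "ext_sq_poly a b c = S * R"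
    using salem_dvd[OF assms(1,3)] by (auto elim: dvdE)
  have ne: "ext_sq_poly a b c \<noteq> 0" by (simp add: ext_sq_poly_def)
  then have "degree R = 0"
    using degree_ext_sq_poly[of a b c] assms(2) unfolding R by (auto simp: degree_mult_eq)
  then obtain r where r: "R = [:r:]" by (auto elim: degree_eq_zeroE)
  have "lead_coeff (ext_sq_poly a b c) = 1" by (simp add: ext_sq_poly_def)
  then have "lead_coeff S * lead_coeff R = 1" unfolding R by (simp only: lead_coeff_mult)
  then have "r = 1" using salemD(2)[OF assms(1)] by (simp add: r)
  then show ?thesis using R r by simp
qed

text \<open>The cofactor of \<open>S\<close> is a monic quadratic with constant term 1. A middle
  coefficient larger than 2 in modulus would give it a real root other than 1 and -1; and
  \<open>lam\<close> and \<open>1 / lam\<close> cannot be its roots because their minimal polynomial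
  has degree 4.\<close>

lemma salem_entropy_degree_4:
  assumes S: "salem lam S" and deg: "degree S = 4" and Q: "ipoly (ext_sq_poly a b c) lam = 0"
    and roots: "\<And>z :: complex. ipoly (ext_sq_poly a b c) z = 0 \<Longrightarrow>
      cmod z = 1 \<or> z = of_real lam \<or> z = of_real (1 / lam)"
  obtains u where "u \<in> {-2, -1, 0, 1, 2}" "ext_sq_poly a b c = S * [:1, u, 1:]"
proof -
  obtain R where R: "ext_sq_poly a b c = S * R"
    using salem_dvd[OF S Q] by (auto elim: dvdE)
  have ne: "ext_sq_poly a b c \<noteq> 0" by (simp add: ext_sq_poly_def)
  then have dR: "degree R = 2"
    using degree_ext_sq_poly[of a b c] deg unfolding R by (auto simp: degree_mult_eq)
  have "lead_coeff (ext_sq_poly a b c) = 1" by (simp add: ext_sq_poly_def)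
  then have lR: "lead_coeff R = 1" unfolding R using salemD(2)[OF S] by (simp add: lead_coeff_mult)
  have "coeff S 0 = lead_coeff (reflect_poly (reflect_poly S))"
    using salemD(2,5)[OF S] by (metis coeff_0_reflect_poly)
  then have "coeff S 0 = 1" using salemD(2,5)[OF S] by simp
  moreover have "coeff (ext_sq_poly a b c) 0 = 1" by (simp add: ext_sq_poly_def)
  ultimately have cR: "coeff R 0 = 1" unfolding R by (simp add: coeff_mult)
  define u where "u = coeff R 1"
  have Ru: "R = [:1, u, 1:]"
    using cR lR dR coeff_eq_0[of R]
    by (intro poly_eqI) (auto simp: u_def coeff_pCons numeral_eq_Suc split: nat.splits)
  have "\<bar>u\<bar> \<le> 2"
  proof (rule ccontr)
    assume "\<not> \<bar>u\<bar> \<le> 2"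
    then have u3: "3 \<le> \<bar>u\<bar>" by simp
    define d where "d = real_of_int u ^ 2 - 4"
    have "d > 0"
    proof -
      have "3 ^ 2 \<le> \<bar>real_of_int u\<bar> ^ 2" using u3 by (intro power_mono) auto
      then show ?thesis unfolding d_def by simp
    qed
    define x where "x = (- real_of_int u + sqrt d) / 2"
    have "x ^ 2 + of_int u * x + 1 = 0"
      using \<open>d > 0\<close> unfolding x_def by (simp add: field_simps power2_eq_square) (simp add: d_def power2_eq_square)
    then have xR: "ipoly R x = 0"
      by (simp add: Ru map_poly_pCons power2_eq_square algebra_simps)
    have "ipoly (ext_sq_poly a b c) (complex_of_real x) = 0"
      unfolding R by (simp add: map_poly_of_int_mult ipoly_of_real xR)
    then have "cmod (of_real x) = 1 \<or> complex_of_real x = of_real lam \<or> complex_of_real x = of_real (1 / lam)"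
      by (rule roots)
    then consider "\<bar>x\<bar> = 1" | "x = lam" | "x = 1 / lam"
      unfolding of_real_eq_iff norm_of_real by blast
    then show False
    proof cases
      case 1
      then have "x = 1 \<or> x = -1" by linarith
      then have "of_int (2 + u) = (0::real) \<or> of_int (2 - u) = (0::real)"
        using \<open>x ^ 2 + of_int u * x + 1 = 0\<close> by auto
      then show False using u3 unfolding of_int_eq_0_iff by linarith
    next
      case 2
      then have "ipoly S x = 0" using salemD(4)[OF S] by simp
      then have "degree S \<le> degree R"
        using irreducible_root_degree[OF salemD(3)[OF S] _ xR] Ru by auto
      then show False using deg dR by simp
    next
      case 3
      then have "ipoly S x = 0" using salem_root_complex(2)[OF S] unfolding ipoly_of_real by simp
      then have "degree S \<le> degree R"
        using irreducible_root_degree[OF salemD(3)[OF S] _ xR] Ru by auto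
      then show False using deg dR by simp
    qed
  qed
  then have "u \<in> {-2, -1, 0, 1, 2}" by auto
  then show ?thesis using that R Ru by simp
qed

text \<open>The cofactor takes the values \<open>2 + u\<close> at 1 and \<open>2 - u\<close> at -1.
  For \<open>u = 2, -1\<close> the first, and for \<open>u = -2, 1\<close> the second, is a nonzero
  square and can be cancelled; \<open>u = 0\<close> leaves the factor 2 at both points.\<close>

lemma salem_entropy_necessary_4:
  assumes S: "salem lam S" and deg: "degree S = 4" and Q: "ipoly (ext_sq_poly a b c) lam = 0"
    and roots: "\<And>z :: complex. ipoly (ext_sq_poly a b c) z = 0 \<Longrightarrow>
      cmod z = 1 \<or> z = of_real lam \<or> z = of_real (1 / lam)"
  shows "(\<exists>m::int. poly S 1 = - (m ^ 2)) \<or> (\<exists>n::int. poly S (-1) = (n ^ 2)) \<or>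
            (\<exists>m n :: int. real_of_int (poly S 1) = - (1/2) * real_of_int m ^ 2 \<and>
                          real_of_int (poly S (-1)) = (1/2) * real_of_int n ^ 2)"
proof -
  obtain u where u: "u \<in> {-2, -1, 0, 1, 2}" and eq: "ext_sq_poly a b c = S * [:1, u, 1:]"
    using salem_entropy_degree_4[OF assms] .
  have e1: "poly S 1 * (2 + u) = - ((a - c)\<^sup>2)"
    using poly_ext_sq_poly_1[of a b c] unfolding eq by (simp add: algebra_simps)
  have e2: "poly S (-1) * (2 - u) = (a + c)\<^sup>2"
    using poly_ext_sq_poly_minus_1[of a b c] unfolding eq by (simp add: algebra_simps)
  have sq: "\<exists>m. x = m\<^sup>2" if "x * 4 = y\<^sup>2" for x y :: int
  proof -
    have "even (y\<^sup>2)" using that by (metis dvd_mult even_numeral)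
    then obtain m where "y = 2 * m" by (auto elim: evenE)
    then show ?thesis using that by (intro exI[of _ m]) (simp add: power2_eq_square)
  qed
  from u consider "u = -2" | "u = -1" | "u = 0" | "u = 1" | "u = 2" by auto
  then show ?thesis
  proof cases
    case 1
    then show ?thesis using e2 sq[of "poly S (-1)" "a + c"] by auto
  next
    case 2
    then show ?thesis using e1 by auto
  next
    case 3
    have "real_of_int (poly S 1 * 2) = of_int (- ((a - c)\<^sup>2))" "real_of_int (poly S (-1) * 2) = of_int ((a + c)\<^sup>2)"
      using e1 e2 3 by simp_all
    then have "real_of_int (poly S 1) = - (1/2) * real_of_int (a - c) ^ 2 \<and>
        real_of_int (poly S (-1)) = (1/2) * real_of_int (a + c) ^ 2"
      by simp
    then show ?thesis by blast
  next
    case 4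
    then show ?thesis using e2 by auto
  next
    case 5
    then have "(- poly S 1) * 4 = (a - c)\<^sup>2" using e1 by simp
    then obtain m where "- poly S 1 = m\<^sup>2" using sq by blast
    then show ?thesis by (metis minus_minus)
  qed
qed

lemma reflect_map_poly_of_int:
  "reflect_poly (map_poly of_int S) = (map_poly of_int (reflect_poly S) :: 'a::{idom,ring_char_0} poly)"
  by (rule poly_eqI) (simp add: coeff_reflect_poly coeff_map_poly)

text \<open>The hypothesis says that \<open>k\<close> is 1 or -1, hence its own inverse in the
  formula \<open>k^d S(1 / k)\<close> for the reflected polynomial.\<close>

lemma poly_reflect_poly_unit:
  fixes S :: "int poly"
  assumes "k * k = 1"
  shows "poly (reflect_poly S) k = k ^ degree S * poly S k"
proof -
  have k: "real_of_int k * real_of_int k = 1"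
    using assms by (metis of_int_1 of_int_mult)
  then have "real_of_int k \<noteq> 0" by auto
  then have "inverse (real_of_int k) = of_int k"
    using k by (simp add: field_simps)
  have "real_of_int (poly (reflect_poly S) k) = poly (reflect_poly (map_poly of_int S)) (of_int k)"
    by (simp add: reflect_map_poly_of_int ipoly_of_int)
  also have "\<dots> = of_int k ^ degree S * ipoly S (of_int k)"
    using \<open>real_of_int k \<noteq> 0\<close> \<open>inverse (real_of_int k) = of_int k\<close>
    by (simp add: poly_reflect_poly_nz)
  also have "\<dots> = real_of_int (k ^ degree S * poly S k)"
    by (simp add: ipoly_of_int)
  finally show ?thesis unfolding of_int_eq_iff .
qed

lemma prod_mset_ge_1:
  fixes f :: "'a \<Rightarrow> real"
  shows "\<forall>x. x \<in># Z \<longrightarrow> 1 \<le> f x \<Longrightarrow> 1 \<le> (\<Prod>x\<in>#Z. f x)"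
proof (induction Z)
  case (add x Z)
  have "1 \<le> f x"
    using add.prems by simp
  moreover have "\<forall>y. y \<in># Z \<longrightarrow> 1 \<le> f y"
    using add.prems by simp
  then have "1 \<le> (\<Prod>x\<in>#Z. f x)"
    by (rule add.IH)
  ultimately have "1 * 1 \<le> f x * (\<Prod>x\<in>#Z. f x)"
    by (intro mult_mono) linarith+
  then show ?case by (simp only: image_mset_add_mset prod_mset.add_mset)
qed simp

lemma norm_poly_prod_linear_0:
  "cmod (poly (\<Prod>x\<in>#Z. [:-x, 1:]) 0) = (\<Prod>x\<in>#Z. cmod x)"
  by (induction Z) (auto simp: norm_mult)

text \<open>Reciprocity is the main point. The constant term of \<open>S\<close> is 1 or -1, so the
  root \<open>lam\<close> outside the unit circle must be balanced by a root inside, and only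
  \<open>1 / lam\<close> is available. Then \<open>S\<close> and its reflection share the root
  \<open>lam\<close> and agree up to a sign, which the value at 1 settles.\<close>

lemma exists_salem:
  assumes lam: "lam > 1" and Q: "ipoly (ext_sq_poly a b c) lam = 0"
    and roots: "\<And>z :: complex. ipoly (ext_sq_poly a b c) z = 0 \<Longrightarrow>
      cmod z = 1 \<or> z = of_real lam \<or> z = of_real (1 / lam)"
  obtains S where "salem lam S" "degree S \<in> {2, 4, 6}"
proof -
  let ?Q = "ext_sq_poly a b c"
  have "?Q \<noteq> 0" by (simp add: ext_sq_poly_def)
  then obtain M where M: "irreducible M" "ipoly M lam = 0" "\<And>R. ipoly R lam = 0 \<Longrightarrow> M dvd R"
    using exists_minimal_int_poly[OF _ Q] by blast
  define S where "S = smult (lead_coeff M) M"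
  obtain R where R: "?Q = M * R" using M(3) Q by (auto elim: dvdE)
  have "lead_coeff ?Q = 1" "coeff ?Q 0 = 1" by (simp_all add: ext_sq_poly_def)
  then have "lead_coeff M * lead_coeff R = 1" "coeff M 0 * coeff R 0 = 1"
    unfolding R lead_coeff_mult by (simp_all add: coeff_mult)
  then have lead_M: "lead_coeff M = 1 \<or> lead_coeff M = -1" and M0: "coeff M 0 = 1 \<or> coeff M 0 = -1"
    by (auto simp: zmult_eq_1_iff)
  have S_cases: "S = M \<or> S = - M" using lead_M by (auto simp: S_def)
  have dvd_S: "S dvd P \<longleftrightarrow> M dvd P" for P
    using S_cases by auto
  have "irreducible (- M)"
  proof (rule irreducibleI)
    show "- M \<noteq> 0" "\<not> - M dvd 1"
      using M(1) by (auto simp: irreducible_def)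
    show "a dvd 1 \<or> b dvd 1" if "- M = a * b" for a b
    proof -
      have "M = (- a) * b" using that by (metis minus_minus mult_minus_left)
      then show ?thesis using irreducibleD[OF M(1)] by fastforce
    qed
  qed
  then have irr: "irreducible S"
    using S_cases M(1) by auto
  have S_lead: "lead_coeff S = 1" using lead_M by (auto simp: S_def)
  have S0: "coeff S 0 = 1 \<or> coeff S 0 = -1" using S_cases M0 by auto
  have S_root: "ipoly S lam = 0"
    unfolding S_def by (simp add: map_poly_of_int_smult M(2))
  have S_ne: "S \<noteq> 0" using irr by auto
  \<comment> \<open>An integer root would make the irreducible \<open>S\<close> divide a linear
    polynomial, and \<open>lam\<close> itself would be 1 or -1.\<close>
  have no_int_root: "poly S 1 \<noteq> 0" "poly S (-1) \<noteq> 0"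
  proof -
    have *: False if "poly S k = 0" "\<bar>k\<bar> = 1" for k :: int
    proof -
      have "ipoly S (of_int k :: real) = 0" using that by (simp add: ipoly_of_int)
      then have "S dvd [:-k, 1:]"
        by (rule irreducible_imp_dvd[OF irr]) (simp add: map_poly_pCons)
      then have "ipoly [:-k, 1:] lam = 0" using S_root by (rule ipoly_dvd)
      then have "lam = of_int k" by (simp add: map_poly_pCons)
      then show False using lam that by linarith
    qed
    show "poly S 1 \<noteq> 0" "poly S (-1) \<noteq> 0" using *[of 1] *[of "-1"] by auto
  qed
  have S_roots: "cmod z = 1 \<or> z = of_real lam \<or> z = of_real (1 / lam)" if "ipoly S z = 0" for z :: complex
  proof -
    have "S dvd ?Q" using dvd_S R by simp
    then show ?thesis using roots ipoly_dvd that by blast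
  qed
  have inv_root: "ipoly S (complex_of_real (1 / lam)) = 0"
  proof (rule ccontr)
    assume nz: "ipoly S (complex_of_real (1 / lam)) \<noteq> 0"
    let ?S = "map_poly of_int S :: complex poly"
    have "lead_coeff ?S = 1" using S_lead by (simp add: coeff_map_poly)
    then have S_eq: "(\<Prod>x\<in>#proots ?S. [:-x, 1:]) = ?S"
      using complex_poly_decompose_multiset[of ?S] by simp
    have "?S \<noteq> 0" using S_ne by simp
    have root_ge: "1 \<le> cmod x" if "x \<in># proots ?S" for x
    proof -
      have "ipoly S x = 0" using that \<open>?S \<noteq> 0\<close> by simp
      then show ?thesis using S_roots[of x] nz lam by auto
    qed
    have "complex_of_real lam \<in># proots ?S"
      using \<open>?S \<noteq> 0\<close> S_root by (simp add: ipoly_of_real)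
    then obtain Z where Z: "proots ?S = add_mset (complex_of_real lam) Z"
      by (metis mset_add)
    have "1 \<le> (\<Prod>x\<in>#Z. cmod x)"
      using root_ge unfolding Z by (intro prod_mset_ge_1) auto
    then have "lam * 1 \<le> lam * (\<Prod>x\<in>#Z. cmod x)"
      using lam by (intro mult_left_mono) auto
    also have "\<dots> = (\<Prod>x\<in>#proots ?S. cmod x)"
      using lam by (simp add: Z)
    also have "\<dots> = cmod (poly ?S 0)"
      by (subst (2) S_eq[symmetric]) (rule norm_poly_prod_linear_0[symmetric])
    also have "\<dots> = 1"
      using S0 by (auto simp: poly_0_coeff_0 coeff_map_poly)
    finally show False using lam by simp
  qed
  have "ipoly (reflect_poly S) lam = 0"
  proof -
    have "ipoly S (1 / lam) = 0" using inv_root unfolding ipoly_of_real by simp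
    then have "poly (reflect_poly (map_poly of_int S)) lam = 0"
      using lam by (subst poly_reflect_poly_nz) (auto simp: field_simps)
    then show ?thesis by (simp add: reflect_map_poly_of_int)
  qed
  then have "S dvd reflect_poly S"
    by (rule irreducible_imp_dvd[OF irr S_root])
  then obtain T where T: "reflect_poly S = S * T" by (auto elim: dvdE)
  have deg_refl: "degree (reflect_poly S) = degree S"
    using S0 by (intro degree_reflect_poly_eq) auto
  have "T \<noteq> 0" using T S_ne by auto
  then have "degree T = 0" using deg_refl S_ne unfolding T by (simp add: degree_mult_eq)
  then obtain e where e: "T = [:e:]" by (auto elim: degree_eq_zeroE)
  have "lead_coeff (reflect_poly S) = e" unfolding T using S_lead by (simp add: lead_coeff_mult e)
  moreover have "lead_coeff (reflect_poly S) = coeff S 0"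
    using S0 deg_refl by (simp add: coeff_reflect_poly)
  ultimately have e_eq: "e = coeff S 0" by simp
  have "poly (reflect_poly S) 1 = poly S 1" using poly_reflect_poly_unit[of 1 S] by simp
  then have "e = 1" unfolding T using no_int_root(1) S0 e_eq by (simp add: e)
  then have refl: "reflect_poly S = S" using T e by simp
  \<comment> \<open>In odd degree a reciprocal polynomial vanishes at -1.\<close>
  have "even (degree S)"
  proof (rule ccontr)
    assume odd: "odd (degree S)"
    then have "poly S (-1) = - poly S (-1)"
      using poly_reflect_poly_unit[of "-1" S] unfolding refl by simp
    then show False using no_int_root(2) by simp
  qed
  moreover have "degree S \<noteq> 0"
  proof
    assume "degree S = 0"
    then have "S = 1" using S_lead by (metis lead_coeff_pCons(2) degree_eq_zeroE one_pCons)
    then show False using S_root by simp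
  qed
  moreover have "degree S \<le> 6"
  proof -
    have "S dvd ?Q" using dvd_S R by simp
    then show ?thesis
      using dvd_imp_degree_le[OF _ \<open>?Q \<noteq> 0\<close>, of S] by (simp only: degree_ext_sq_poly)
  qed
  ultimately have deg: "degree S \<in> {2, 4, 6}"
  proof -
    obtain k where k: "degree S = 2 * k" using \<open>even (degree S)\<close> by (rule evenE)
    then have "k = 1 \<or> k = 2 \<or> k = 3" using \<open>degree S \<noteq> 0\<close> \<open>degree S \<le> 6\<close> by linarith
    then show ?thesis using k by auto
  qed
  have "complex_of_real lam \<noteq> 0" "cmod (of_real lam) \<noteq> 1" "cmod (of_real (1 / lam)) \<noteq> 1"
    using lam by (simp_all add: norm_divide)
  then have "{z :: complex. ipoly S z = 0 \<and> cmod z \<noteq> 1} = {complex_of_real lam, complex_of_real (1 / lam)}"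
    using S_roots inv_root S_root ipoly_of_real[of S lam] by (auto simp del: of_real_divide)
  then have "salem lam S"
    using lam S_lead irr S_root refl by (simp add: salem_def min_poly_Z_def)
  then show ?thesis using that deg by blast
qed

section \<open>Lattices and affine lifts\<close>

lemma lattice4E:
  assumes "lattice4 L"
  obtains v :: "4 \<Rightarrow> complex ^ 2" where
    "inj v" "independent (range v)"
    "\<And>n :: 4 \<Rightarrow> int. (\<Sum>i\<in>UNIV. real_of_int (n i) *\<^sub>R v i) \<in> L"
    "\<And>l. l \<in> L \<Longrightarrow> \<exists>n :: 4 \<Rightarrow> int. l = (\<Sum>i\<in>UNIV. real_of_int (n i) *\<^sub>R v i)"
proof -
  obtain v :: "4 \<Rightarrow> complex ^ 2" where v: "inj v" "independent (range v)"
    and L: "L = {(\<Sum>i\<in>UNIV. real_of_int (n i) *\<^sub>R v i) | n :: 4 \<Rightarrow> int. True}"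
    using assms unfolding lattice4_def by blast
  show ?thesis
    by (rule that[OF v]) (unfold L, blast, blast)
qed

lemma basis4_inj:
  fixes v :: "4 \<Rightarrow> 'a::real_vector"
  assumes "inj v" "independent (range v)" "(\<Sum>i\<in>UNIV. x i *\<^sub>R v i) = 0"
  shows "x i = 0"
proof -
  have "(\<Sum>u\<in>range v. x (inv v u) *\<^sub>R u) = (\<Sum>i\<in>UNIV. x i *\<^sub>R v i)"
    using assms(1) by (subst sum.reindex) (auto simp: inv_f_f)
  then have "x (inv v (v i)) = 0"
    using independentD[OF assms(2), of "range v" "\<lambda>u. x (inv v u)" "v i"] assms(3) by simp
  then show ?thesis using assms(1) by (simp add: inv_f_f)
qed

lemma basis4_span:
  fixes v :: "4 \<Rightarrow> complex ^ 2"
  assumes "inj v" "independent (range v)"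
  obtains x where "z = (\<Sum>i\<in>UNIV. x i *\<^sub>R v i)"
proof -
  have card: "card (range v) = DIM(complex ^ 2)"
    using assms(1) by (simp add: card_image)
  have "UNIV \<subseteq> span (range v)"
    using assms(2) card by (intro card_ge_dim_independent) (simp_all add: dim_UNIV)
  then have "z \<in> span (range v)" by blast
  then obtain u where "(\<Sum>w\<in>range v. u w *\<^sub>R w) = z"
    using span_finite[of "range v"] by auto
  moreover have "(\<Sum>w\<in>range v. u w *\<^sub>R w) = (\<Sum>i\<in>UNIV. u (v i) *\<^sub>R v i)"
    using assms(1) by (subst sum.reindex) auto
  ultimately show ?thesis using that by metis
qed

lemma lattice4_zero:
  assumes "lattice4 L"
  shows "0 \<in> L"
proof -
  obtain v :: "4 \<Rightarrow> complex ^ 2" where v: "inj v" "independent (range v)"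
    and L_I: "\<And>n :: 4 \<Rightarrow> int. (\<Sum>i\<in>UNIV. real_of_int (n i) *\<^sub>R v i) \<in> L"
    and L_E: "\<And>l. l \<in> L \<Longrightarrow> \<exists>n :: 4 \<Rightarrow> int. l = (\<Sum>i\<in>UNIV. real_of_int (n i) *\<^sub>R v i)"
    using assms by (rule lattice4E) (rule that)
  from L_I[of "\<lambda>_. 0"] show ?thesis by simp
qed

lemma lattice4_add:
  assumes "lattice4 L" "x \<in> L" "y \<in> L"
  shows "x + y \<in> L"
proof -
  obtain v :: "4 \<Rightarrow> complex ^ 2" where v: "inj v" "independent (range v)"
    and L_I: "\<And>n :: 4 \<Rightarrow> int. (\<Sum>i\<in>UNIV. real_of_int (n i) *\<^sub>R v i) \<in> L"
    and L_E: "\<And>l. l \<in> L \<Longrightarrow> \<exists>n :: 4 \<Rightarrow> int. l = (\<Sum>i\<in>UNIV. real_of_int (n i) *\<^sub>R v i)"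
    using assms(1) by (rule lattice4E) (rule that)
  obtain n m where "x = (\<Sum>i\<in>UNIV. real_of_int (n i) *\<^sub>R v i)" "y = (\<Sum>i\<in>UNIV. real_of_int (m i) *\<^sub>R v i)"
    using L_E[OF assms(2)] L_E[OF assms(3)] by blast
  then have "x + y = (\<Sum>i\<in>UNIV. real_of_int (n i + m i) *\<^sub>R v i)"
    by (simp add: scaleR_add_left sum.distrib)
  then show ?thesis using L_I[of "\<lambda>i. n i + m i"] by simp
qed

lemma lattice4_minus:
  assumes "lattice4 L" "x \<in> L"
  shows "- x \<in> L"
proof -
  obtain v :: "4 \<Rightarrow> complex ^ 2" where v: "inj v" "independent (range v)"
    and L_I: "\<And>n :: 4 \<Rightarrow> int. (\<Sum>i\<in>UNIV. real_of_int (n i) *\<^sub>R v i) \<in> L"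
    and L_E: "\<And>l. l \<in> L \<Longrightarrow> \<exists>n :: 4 \<Rightarrow> int. l = (\<Sum>i\<in>UNIV. real_of_int (n i) *\<^sub>R v i)"
    using assms(1) by (rule lattice4E) (rule that)
  obtain n where "x = (\<Sum>i\<in>UNIV. real_of_int (n i) *\<^sub>R v i)"
    using L_E[OF assms(2)] by blast
  then have "- x = (\<Sum>i\<in>UNIV. real_of_int (- n i) *\<^sub>R v i)"
    by (simp add: sum_negf)
  then show ?thesis using L_I[of "\<lambda>i. - n i"] by simp
qed

lemma lattice4_diff: "lattice4 L \<Longrightarrow> x \<in> L \<Longrightarrow> y \<in> L \<Longrightarrow> x - y \<in> L"
  using lattice4_add[of L x "- y"] lattice4_minus by simp

text \<open>The coordinate map of a basis is linear and injective in finite dimension, hence bounded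
  below by a multiple of the norm, and a nonzero integer vector has norm at least 1.\<close>

lemma lattice4_discrete:
  assumes "lattice4 L"
  obtains \<rho> where "\<rho> > 0" "\<And>l. l \<in> L \<Longrightarrow> l \<noteq> 0 \<Longrightarrow> \<rho> \<le> norm l"
proof -
  obtain v :: "4 \<Rightarrow> complex ^ 2" where v: "inj v" "independent (range v)"
    and L_I: "\<And>n :: 4 \<Rightarrow> int. (\<Sum>i\<in>UNIV. real_of_int (n i) *\<^sub>R v i) \<in> L"
    and L_E: "\<And>l. l \<in> L \<Longrightarrow> \<exists>n :: 4 \<Rightarrow> int. l = (\<Sum>i\<in>UNIV. real_of_int (n i) *\<^sub>R v i)"
    using assms by (rule lattice4E) (rule that)
  define \<Phi> where "\<Phi> = (\<lambda>x :: real ^ 4. \<Sum>i\<in>UNIV. (x $ i) *\<^sub>R v i)"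
  have "linear \<Phi>"
    by (rule linearI) (simp_all add: \<Phi>_def scaleR_add_left sum.distrib scaleR_sum_right)
  moreover have "inj \<Phi>"
    unfolding linear_injective_0[OF \<open>linear \<Phi>\<close>]
    by (auto simp: \<Phi>_def vec_eq_iff intro: basis4_inj[OF v])
  ultimately obtain B where B: "B > 0" "\<And>x. B * norm x \<le> norm (\<Phi> x)"
    using linear_inj_bounded_below_pos by blast
  have "B \<le> norm l" if l_L: "l \<in> L" and l_0: "l \<noteq> 0" for l
  proof -
    obtain n where l: "l = (\<Sum>i\<in>UNIV. real_of_int (n i) *\<^sub>R v i)"
      using L_E[OF l_L] by blast
    then have l': "l = \<Phi> (\<chi> i. real_of_int (n i))" by (simp add: \<Phi>_def)
    obtain i where "n i \<noteq> 0"
    proof (rule ccontr)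
      assume "\<not> thesis"
      then have "n i = 0" for i using that by blast
      then show False using l l_0 by simp
    qed
    then have "1 \<le> \<bar>real_of_int (n i)\<bar>" by linarith
    also have "\<dots> \<le> norm (\<chi> i. real_of_int (n i))"
      using component_le_norm_cart[of "\<chi> i. real_of_int (n i)" i] by simp
    finally have "B * 1 \<le> B * norm (\<chi> i. real_of_int (n i))"
      using B(1) by (intro mult_left_mono) auto
    also have "\<dots> \<le> norm l" unfolding l' by (rule B(2))
    finally show ?thesis by simp
  qed
  then show ?thesis using that B(1) by blast
qed

lemma lattice4_cocompact:
  assumes "lattice4 L"
  obtains R where "\<And>z. \<exists>l\<in>L. norm (z - l) \<le> R"
proof -
  obtain v :: "4 \<Rightarrow> complex ^ 2" where v: "inj v" "independent (range v)"
    and L_I: "\<And>n :: 4 \<Rightarrow> int. (\<Sum>i\<in>UNIV. real_of_int (n i) *\<^sub>R v i) \<in> L"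
    and L_E: "\<And>l. l \<in> L \<Longrightarrow> \<exists>n :: 4 \<Rightarrow> int. l = (\<Sum>i\<in>UNIV. real_of_int (n i) *\<^sub>R v i)"
    using assms by (rule lattice4E) (rule that)
  have "\<exists>l\<in>L. norm (z - l) \<le> (\<Sum>i\<in>UNIV. norm (v i))" for z
  proof -
    obtain x where z: "z = (\<Sum>i\<in>UNIV. x i *\<^sub>R v i)"
      using basis4_span[OF v] by blast
    define l where "l = (\<Sum>i\<in>UNIV. real_of_int \<lfloor>x i\<rfloor> *\<^sub>R v i)"
    have "l \<in> L" unfolding l_def by (rule L_I)
    have "z - l = (\<Sum>i\<in>UNIV. frac (x i) *\<^sub>R v i)"
      by (simp add: z l_def frac_def scaleR_diff_left sum_subtractf)
    also have "norm \<dots> \<le> (\<Sum>i\<in>UNIV. norm (frac (x i) *\<^sub>R v i))"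
      by (rule norm_sum)
    also have "\<dots> \<le> (\<Sum>i\<in>UNIV. norm (v i))"
      by (intro sum_mono) (simp add: mult_left_le_one_le less_imp_le[OF frac_lt_1])
    finally show ?thesis using \<open>l \<in> L\<close> by blast
  qed
  then show ?thesis using that by blast
qed

text \<open>The distance to \<open>f x\<close> is either 0 or at least \<rho>, and a connected range
  cannot jump over this gap.\<close>

lemma continuous_into_lattice_constant:
  assumes L: "lattice4 L" and cont: "continuous_on UNIV f" and into: "\<And>z :: complex ^ 2. f z \<in> L"
  shows "f x = f y"
proof -
  obtain \<rho> where \<rho>: "\<rho> > 0" "\<And>l. l \<in> L \<Longrightarrow> l \<noteq> 0 \<Longrightarrow> \<rho> \<le> norm l"
    using lattice4_discrete[OF L] by blast
  define h where "h z = norm (f z - f x)" for z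
  have h: "h z = 0 \<or> \<rho> \<le> h z" for z
    using \<rho>(2)[of "f z - f x"] lattice4_diff[OF L] into by (auto simp: h_def)
  have "connected (range h)"
    unfolding h_def using cont by (intro connected_continuous_image continuous_intros connected_UNIV)
  have "h y = 0"
  proof (rule ccontr)
    assume "h y \<noteq> 0"
    then have "\<rho> \<le> h y" using h by blast
    moreover have "h x = 0" by (simp add: h_def)
    ultimately have "\<rho> / 2 \<in> range h"
      using connectedD_interval[OF \<open>connected (range h)\<close>, of "h x" "h y" "\<rho> / 2"] \<rho>(1) by simp
    then obtain z where "h z = \<rho> / 2" by (metis imageE)
    then show False using h[of z] \<rho>(1) by auto
  qed
  then show ?thesis by (simp add: h_def)
qed

section \<open>Lifts of holomorphic torus maps are affine\<close>

lemma holo2_continuous: "holo2 f \<Longrightarrow> continuous_on UNIV f"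
  unfolding holo2_def
  by (metis continuous_at_imp_continuous_on has_derivative_continuous)

lemma descends_translate:
  assumes L: "lattice4 L" and "descends L f" "continuous_on UNIV f" "l \<in> L"
  shows "f (x + l) - f x = f (y + l) - f y"
proof -
  have "continuous_on UNIV (\<lambda>z. f (z + l) - f z)"
    by (intro continuous_intros continuous_on_compose2[OF assms(3)] assms(3)) auto
  then show ?thesis
    using continuous_into_lattice_constant[OF L] assms(2,4) unfolding descends_def by blast
qed

text \<open>A lattice translate brings a pair of nearby points into a fixed compact set without changing
  the difference of the values of \<open>f\<close>; summing along a chain gives linear growth.\<close>

lemma descends_linear_growth:
  assumes L: "lattice4 L" and f: "descends L f" "continuous_on UNIV f"
  obtains K where "K \<ge> 0" "\<And>z. norm (f z) \<le> K * (norm z + 3)"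
proof -
  obtain R where R: "\<And>z. \<exists>l\<in>L. norm (z - l) \<le> R"
    using lattice4_cocompact[OF L] by blast
  have "compact (f ` cball 0 (R + 1))"
    using f(2) by (intro compact_continuous_image) (auto intro: continuous_on_subset)
  then obtain K0 where "\<forall>y\<in>f ` cball 0 (R + 1). norm y \<le> K0"
    using compact_imp_bounded bounded_iff by metis
  then have K0: "norm (f z) \<le> K0" if "norm z \<le> R + 1" for z
    using that by simp
  have "0 \<le> R" using R[of 0] norm_ge_zero order_trans by blast
  then have "0 \<le> K0" using K0[of 0] norm_ge_zero order_trans by (metis add_nonneg_nonneg norm_zero zero_le_one)
  have near: "norm (f x - f y) \<le> 2 * K0" if "norm (x - y) \<le> 1" for x y
  proof -
    obtain l where l: "l \<in> L" "norm (y - l) \<le> R" using R by blast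
    have "norm (x - l) \<le> norm (y - l) + norm (x - y)"
      using norm_triangle_ineq[of "y - l" "x - y"] by simp
    then have "norm (f (x - l)) \<le> K0" "norm (f (y - l)) \<le> K0"
      using l(2) that by (auto intro!: K0)
    moreover have "f x - f y = f (x - l) - f (y - l)"
      using descends_translate[OF L f l(1), of "x - l" "y - l"] by (simp add: algebra_simps)
    ultimately show ?thesis
      using norm_triangle_ineq4[of "f (x - l)" "f (y - l)"] by simp
  qed
  have chain: "norm (f (real k *\<^sub>R w) - f 0) \<le> 2 * K0 * real k" if "norm w \<le> 1" for k w
  proof (induction k)
    case (Suc k)
    have "norm (real (Suc k) *\<^sub>R w - real k *\<^sub>R w) \<le> 1"
      using that by (simp add: scaleR_add_left)
    then have "norm (f (real (Suc k) *\<^sub>R w) - f (real k *\<^sub>R w)) \<le> 2 * K0"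
      by (rule near)
    then show ?case
      using Suc norm_triangle_ineq[of "f (real (Suc k) *\<^sub>R w) - f (real k *\<^sub>R w)" "f (real k *\<^sub>R w) - f 0"]
      by (simp add: algebra_simps)
  qed simp
  have "norm (f z) \<le> 2 * K0 * (norm z + 3)" for z
  proof -
    \<comment> \<open>The extra 1 keeps \<open>N\<close> positive at \<open>z = 0\<close>. Together
      with the rounding it accounts for 2 of the 3 in the growth bound; the last unit absorbs
      \<open>f 0\<close>.\<close>
    define N where "N = nat \<lceil>norm z\<rceil> + 1"
    have N: "norm z \<le> real N" "real N \<le> norm z + 2" "N > 0"
      using norm_ge_zero[of z] unfolding N_def by linarith+
    define w where "w = inverse (real N) *\<^sub>R z"
    have "norm w \<le> 1" using N by (simp add: w_def field_simps)
    moreover have "real N *\<^sub>R w = z" using N by (simp add: w_def)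
    ultimately have "norm (f z - f 0) \<le> 2 * K0 * real N"
      using chain[of w N] by simp
    also have "\<dots> \<le> 2 * K0 * (norm z + 2)"
      using \<open>0 \<le> K0\<close> N by (intro mult_left_mono) auto
    finally have "norm (f z) \<le> 2 * K0 * (norm z + 2) + norm (f 0)"
      using norm_triangle_ineq[of "f z - f 0" "f 0"] by simp
    also have "\<dots> \<le> 2 * K0 * (norm z + 2) + 2 * K0"
      using K0[of 0] \<open>0 \<le> R\<close> \<open>0 \<le> K0\<close> by simp
    finally show ?thesis by (simp add: algebra_simps)
  qed
  then show ?thesis using that[of "2 * K0"] \<open>0 \<le> K0\<close> by simp
qed

lemma scaleR_eq_smult: "r *\<^sub>R (x :: complex ^ 'n) = complex_of_real r *s x"
  unfolding vec_eq_iff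
  by (simp only: vector_scaleR_component vector_smult_component) (simp add: scaleR_conv_of_real)

lemma norm_smult: "norm (c *s (x :: complex ^ 'n)) = cmod c * norm x"
  by (simp add: norm_vec_def L2_set_def norm_mult power_mult_distrib
      sum_distrib_left[symmetric] real_sqrt_mult)

definition complex_linear2 :: "(complex ^ 2 \<Rightarrow> complex ^ 2) \<Rightarrow> bool" where
  "complex_linear2 A \<longleftrightarrow> (\<forall>x y. A (x + y) = A x + A y) \<and> (\<forall>c x. A (c *s x) = c *s A x)"

lemma holo2_slice:
  assumes "holo2 f"
  shows "((\<lambda>t. f (t *s w) $ i) has_field_derivative
    (frechet_derivative f (at (t *s w)) w $ i)) (at t)"
proof -
  let ?D = "frechet_derivative f (at (t *s w))"
  obtain D where D: "(f has_derivative D) (at (t *s w))" "\<And>c w. D (c *s w) = c *s D w"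
    using assms unfolding holo2_def by blast
  have "?D = D" using frechet_derivative_at[OF D(1)] by simp
  have "bounded_linear (\<lambda>t :: complex. t *s w)"
    by (rule bounded_linear_intro[of _ "norm w"])
      (auto simp: vec_eq_iff algebra_simps norm_smult)
  then have "((\<lambda>t. t *s w) has_derivative (\<lambda>t. t *s w)) (at t)"
    by (rule bounded_linear_imp_has_derivative)
  then have "((\<lambda>t. f (t *s w)) has_derivative (\<lambda>t. D (t *s w))) (at t)"
    using D(1) has_derivative_compose by blast
  then have "((\<lambda>t. f (t *s w) $ i) has_derivative (\<lambda>t. D (t *s w) $ i)) (at t)"
    by (rule bounded_linear.has_derivative[OF bounded_linear_vec_nth])
  moreover have "(\<lambda>t. D (t *s w) $ i) = (*) (D w $ i)"
    by (simp add: D(2) fun_eq_iff mult.commute)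
  ultimately show ?thesis
    unfolding \<open>?D = D\<close> has_field_derivative_def by simp
qed

text \<open>On every complex line through 0 a component of \<open>f\<close> is entire of at most
  linear growth, hence a polynomial of degree at most 1. All slopes come from the one derivative
  \<open>A\<close> of \<open>f\<close> at 0, so the lines fit together to a single affine
  map.\<close>

lemma descends_holo2_affine:
  assumes L: "lattice4 L" and f: "descends L f" "holo2 f"
  obtains A where "complex_linear2 A" "\<And>z. f z = f 0 + A z"
proof -
  have cont: "continuous_on UNIV f" using f(2) by (rule holo2_continuous)
  obtain K where K: "K \<ge> 0" "\<And>z. norm (f z) \<le> K * (norm z + 3)"
    using descends_linear_growth[OF L f(1) cont] by blast
  obtain A where A: "(f has_derivative A) (at 0)" "\<And>c w. A (c *s w) = c *s A w"
    using f(2) unfolding holo2_def by blast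
  have A_fre: "frechet_derivative f (at 0) = A"
    using frechet_derivative_at[OF A(1)] by simp
  have comp: "f z $ i = f 0 $ i + A z $ i" for z i
  proof -
    define h where "h t = f (t *s z) $ i" for t
    have holo: "h holomorphic_on UNIV"
      unfolding h_def using holo2_slice[OF f(2)]
      by (auto simp: holomorphic_on_def field_differentiable_def)
    have bd: "norm (h t) \<le> K * (norm z + 3) * norm t ^ 1" if "1 \<le> norm t" for t
    proof -
      have "norm (h t) \<le> norm (f (t *s z))"
        unfolding h_def by (rule Finite_Cartesian_Product.norm_nth_le)
      also have "\<dots> \<le> K * (norm (t *s z) + 3)" by (rule K(2))
      also have "norm (t *s z) = norm t * norm z"
        by (rule norm_smult)
      also have "K * (norm t * norm z + 3) \<le> K * (norm t * norm z + 3 * norm t)"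
        using that K(1) by (intro mult_left_mono) auto
      finally show ?thesis by (simp add: algebra_simps)
    qed
    have "h 1 = (\<Sum>k\<le>1. (deriv ^^ k) h 0 / fact k * 1 ^ k)"
      by (rule Liouville_polynomial[OF holo bd])
    also have "\<dots> = h 0 + deriv h 0" by simp
    also have "deriv h 0 = A z $ i"
      using holo2_slice[OF f(2), of z i 0] unfolding h_def by (simp add: A_fre DERIV_imp_deriv)
    finally show ?thesis by (simp add: h_def)
  qed
  have "f z = f 0 + A z" for z
    unfolding vec_eq_iff vector_add_component using comp[of z] by blast
  moreover have "complex_linear2 A"
    unfolding complex_linear2_def using A(2) linear_add[OF has_derivative_linear[OF A(1)]] by blast
  ultimately show ?thesis using that by blast
qed

lemma complex_linear2_scaleR: "complex_linear2 A \<Longrightarrow> A (r *\<^sub>R x) = r *\<^sub>R A x"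
  by (simp add: scaleR_eq_smult complex_linear2_def)

lemma complex_linear2_zero: "complex_linear2 A \<Longrightarrow> A 0 = 0"
  using complex_linear2_scaleR[of A 0 0] by simp

lemma complex_linear2_diff: "complex_linear2 A \<Longrightarrow> A (x - y) = A x - A y"
proof -
  assume "complex_linear2 A"
  then have "A (x - y + y) = A (x - y) + A y" unfolding complex_linear2_def by blast
  then show ?thesis by simp
qed

text \<open>By linearity a nonzero value could be scaled down to a nonzero lattice vector shorter
  than \<rho>.\<close>

lemma complex_linear2_into_lattice:
  assumes L: "lattice4 L" and A: "complex_linear2 A" and into: "\<And>z. A z \<in> L"
  shows "A z = 0"
proof (rule ccontr)
  assume nz: "A z \<noteq> 0"
  obtain \<rho> where \<rho>: "\<rho> > 0" "\<And>l. l \<in> L \<Longrightarrow> l \<noteq> 0 \<Longrightarrow> \<rho> \<le> norm l"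
    using lattice4_discrete[OF L] by blast
  define r where "r = \<rho> / (2 * norm (A z))"
  have "r > 0" using nz \<rho>(1) by (simp add: r_def)
  have "A (r *\<^sub>R z) = r *\<^sub>R A z" by (rule complex_linear2_scaleR[OF A])
  then have "A (r *\<^sub>R z) \<noteq> 0" "norm (A (r *\<^sub>R z)) = \<rho> / 2"
    using nz \<open>r > 0\<close> \<rho>(1) by (simp_all add: r_def)
  then show False using \<rho>(2)[OF into, of "r *\<^sub>R z"] \<rho>(1) by simp
qed

lemma torus_aut_affine:
  assumes L: "lattice4 L" and f: "torus_aut L f"
  obtains A B where "complex_linear2 A" "complex_linear2 B" "\<And>z. f z = f 0 + A z"
    "\<And>l. l \<in> L \<Longrightarrow> A l \<in> L" "\<And>l. l \<in> L \<Longrightarrow> B l \<in> L"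
    "\<And>z. B (A z) = z" "\<And>z. A (B z) = z"
proof -
  obtain g where g: "descends L g" "holo2 g" "\<And>z. g (f z) - z \<in> L" "\<And>z. f (g z) - z \<in> L"
    and f': "descends L f" "holo2 f"
    using f unfolding torus_aut_def by blast
  obtain A where A: "complex_linear2 A" "\<And>z. f z = f 0 + A z"
    using descends_holo2_affine[OF L f'] by blast
  obtain B where B: "complex_linear2 B" "\<And>z. g z = g 0 + B z"
    using descends_holo2_affine[OF L g(1,2)] by blast
  have AL: "A l \<in> L" if "l \<in> L" for l
  proof -
    have "f (0 + l) - f 0 \<in> L" using f'(1) that unfolding descends_def by blast
    then show ?thesis using A(2)[of l] by simp
  qed
  have BL: "B l \<in> L" if "l \<in> L" for l
  proof -
    have "g (0 + l) - g 0 \<in> L" using g(1) that unfolding descends_def by blast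
    then show ?thesis using B(2)[of l] by simp
  qed
  \<comment> \<open>The composite of the lifts differs from the identity by a map into
    \<open>L\<close>. Subtracting its value at 0 leaves the linear map \<open>D (C z) - z\<close>,
    still with values in \<open>L\<close>, so it vanishes. The maps are generic in order to cover
    both compositions.\<close>
  have inverse: "D (C z) = z"
    if C: "complex_linear2 C" "\<And>z. p z = p 0 + C z" and D: "complex_linear2 D" "\<And>z. q z = q 0 + D z"
      and inv: "\<And>z. q (p z) - z \<in> L" for C D p q z
  proof -
    have eq: "q (p z) - z - (q (p 0) - 0) = D (C z) - z" for z
      using C(2)[of z] D(2)[of "p z"] D(2)[of "p 0"] D(1) by (simp add: complex_linear2_def)
    have "D (C z) - z \<in> L" for z
      unfolding eq[symmetric] by (intro lattice4_diff[OF L] inv)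
    moreover have "complex_linear2 (\<lambda>z. D (C z) - z)"
      using C(1) D(1) by (simp add: complex_linear2_def vector_ssub_ldistrib algebra_simps)
    ultimately have "D (C z) - z = 0"
      by (intro complex_linear2_into_lattice[OF L])
    then show ?thesis by simp
  qed
  show ?thesis
    using that[OF A(1) B(1) A(2) AL BL inverse[OF A B g(3)] inverse[OF B A g(4)]] .
qed

section \<open>Entropy of affine maps\<close>

text \<open>Pigeonhole on four real coordinates, rounded down to multiples of \<open>s1\<close> and
  \<open>s2\<close>. Points of a common cell differ by at most \<open>s\<close> in real and in
  imaginary part, whence the 2 in \<open>sep\<close>; \<open>2 * N + 1\<close> values per coordinate
  with \<open>N \<le> B / s + 1\<close> give the 3.\<close>

lemma card_le_grid:
  fixes p q :: "'a \<Rightarrow> complex"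
  assumes fin: "finite E" and s: "s1 > 0" "s2 > 0" and B: "0 \<le> B"
    and bd: "\<And>x. x \<in> E \<Longrightarrow> cmod (p x) \<le> B" "\<And>x. x \<in> E \<Longrightarrow> cmod (q x) \<le> B"
    and sep: "\<And>x y. x \<in> E \<Longrightarrow> y \<in> E \<Longrightarrow> cmod (p x - p y) \<le> 2 * s1 \<Longrightarrow> cmod (q x - q y) \<le> 2 * s2 \<Longrightarrow> x = y"
  shows "real (card E) \<le> (2 * B / s1 + 3)\<^sup>2 * (2 * B / s2 + 3)\<^sup>2"
proof -
  define N where "N s = \<lceil>B / s\<rceil>" for s
  define F :: "real \<Rightarrow> real \<Rightarrow> int" where "F s t = \<lfloor>t / s\<rfloor>" for s t
  have F_in: "F s t \<in> {- N s..N s}" if "s > 0" "\<bar>t\<bar> \<le> B" for s t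
  proof -
    have "t / s \<le> B / s" "- (B / s) \<le> t / s"
      using that by (auto simp: divide_simps abs_le_iff)
    then show ?thesis unfolding F_def N_def by (auto, linarith+)
  qed
  have F_eq: "\<bar>t - t'\<bar> \<le> s" if "s > 0" "F s t = F s t'" for s t t'
  proof -
    have "\<bar>t / s - t' / s\<bar> \<le> 1" using that(2) unfolding F_def by linarith
    then have "\<bar>(t - t') / s\<bar> \<le> 1" by (simp add: diff_divide_distrib)
    then show ?thesis using that(1) by (simp add: abs_divide)
  qed
  have cmod_le: "cmod (z - w) \<le> 2 * s"
    if "s > 0" "F s (Re z) = F s (Re w)" "F s (Im z) = F s (Im w)" for s z w
    using cmod_le[of "z - w"] F_eq[OF that(1,2)] F_eq[OF that(1,3)] by simp
  define G where "G x = ((F s1 (Re (p x)), F s1 (Im (p x))), (F s2 (Re (q x)), F s2 (Im (q x))))" for x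
  define T where "T = ({- N s1..N s1} \<times> {- N s1..N s1}) \<times> ({- N s2..N s2} \<times> {- N s2..N s2})"
  have "inj_on G E"
    by (intro inj_onI sep) (auto simp: G_def intro!: cmod_le s)
  moreover have "G ` E \<subseteq> T"
    using order_trans[OF abs_Re_le_cmod bd(1)] order_trans[OF abs_Im_le_cmod bd(1)]
      order_trans[OF abs_Re_le_cmod bd(2)] order_trans[OF abs_Im_le_cmod bd(2)]
    by (auto simp: G_def T_def simp del: atLeastAtMost_iff intro!: F_in s)
  ultimately have "card E \<le> card T"
    by (intro card_inj_on_le) (auto simp: T_def)
  then have "real (card E) \<le> real (card T)" by simp
  also have "\<dots> = (real (nat (2 * N s1 + 1)))\<^sup>2 * (real (nat (2 * N s2 + 1)))\<^sup>2"
    by (simp add: T_def card_cartesian_product power2_eq_square algebra_simps)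
  also have "\<dots> \<le> (2 * B / s1 + 3)\<^sup>2 * (2 * B / s2 + 3)\<^sup>2"
  proof -
    have "real (nat (2 * N s + 1)) \<le> 2 * B / s + 3" if "s > 0" for s
    proof -
      have "0 \<le> B / s" using B that by simp
      then show ?thesis unfolding N_def by linarith
    qed
    then show ?thesis using s by (intro mult_mono power_mono) auto
  qed
  finally show ?thesis .
qed

lemma tdist_le:
  assumes "l \<in> L"
  shows "tdist L x y \<le> norm (x - y - l)"
  unfolding tdist_def using assms by (intro cInf_lower) (auto intro!: bdd_belowI[of _ 0])

lemma tdist_ge:
  assumes "lattice4 L" "\<And>l. l \<in> L \<Longrightarrow> c \<le> norm (x - y - l)"
  shows "c \<le> tdist L x y"
  unfolding tdist_def using assms lattice4_zero by (intro cInf_greatest) auto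

text \<open>In the coordinates \<open>l1\<close>, \<open>l2\<close> the linear part is upper
  triangular with off-diagonal entry \<open>be\<close>, and \<open>u1\<close> spans the eigenline of
  \<open>al1\<close>. The last hypothesis allows a shear only for \<open>cmod al1 = 1\<close>, where
  it contributes linear growth.\<close>

locale torus_map_coords =
  fixes L :: "(complex ^ 2) set" and f A :: "complex ^ 2 \<Rightarrow> complex ^ 2"
    and l1 l2 :: "complex ^ 2 \<Rightarrow> complex" and u1 u2 :: "complex ^ 2" and al1 al2 be :: complex
  assumes L: "lattice4 L"
    and A: "complex_linear2 A" and f_eq: "\<And>z. f z = f 0 + A z"
    and A_L: "\<And>l. l \<in> L \<Longrightarrow> A l \<in> L"
    and l1_add: "\<And>x y. l1 (x + y) = l1 x + l1 y" and l1_scale: "\<And>c x. l1 (c *s x) = c * l1 x"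
    and l2_add: "\<And>x y. l2 (x + y) = l2 x + l2 y" and l2_scale: "\<And>c x. l2 (c *s x) = c * l2 x"
    and coords: "\<And>z. z = l1 z *s u1 + l2 z *s u2"
    and l1_u1: "l1 u1 = 1" and l2_u1: "l2 u1 = 0"
    and l1_A: "\<And>z. l1 (A z) = al1 * l1 z + be * l2 z"
    and l2_A: "\<And>z. l2 (A z) = al2 * l2 z"
    and al: "1 \<le> cmod al1" "cmod al2 \<le> 1" and be: "be = 0 \<or> cmod al1 = 1"
begin

lemma l1_diff: "l1 (x - y) = l1 x - l1 y"
  using l1_add[of "x - y" y] by simp

lemma l2_diff: "l2 (x - y) = l2 x - l2 y"
  using l2_add[of "x - y" y] by simp

lemma A_diff: "A (x - y) = A x - A y"
  by (rule complex_linear2_diff[OF A])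

lemma A_pow_diff: "(A ^^ k) (x - y) = (A ^^ k) x - (A ^^ k) y"
  by (induction k) (simp_all add: A_diff)

lemma A_pow_L: "l \<in> L \<Longrightarrow> (A ^^ k) l \<in> L"
  by (induction k) (simp_all add: A_L)

lemma f_pow_diff: "(f ^^ k) x - (f ^^ k) y = (A ^^ k) (x - y)"
proof (induction k)
  case (Suc k)
  have "(f ^^ Suc k) x - (f ^^ Suc k) y = A ((f ^^ k) x) - A ((f ^^ k) y)"
    using f_eq[of "(f ^^ k) x"] f_eq[of "(f ^^ k) y"] by simp
  also have "\<dots> = A ((A ^^ k) (x - y))"
    by (simp add: A_diff[symmetric] Suc)
  finally show ?case by simp
qed simp

lemma norm_le_coords: "norm z \<le> cmod (l1 z) * norm u1 + cmod (l2 z) * norm u2"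
  by (subst coords[of z], rule order_trans[OF norm_triangle_ineq]) (simp add: norm_smult)

lemma coords_bounded:
  obtains C where "C \<ge> 0" "\<And>z. cmod (l1 z) \<le> C * norm z" "\<And>z. cmod (l2 z) \<le> C * norm z"
proof -
  have "linear l1" "linear l2"
    by (auto intro!: linearI simp: l1_add l2_add scaleR_eq_smult l1_scale l2_scale scaleR_conv_of_real)
  then have "bounded_linear l1" "bounded_linear l2"
    by (simp_all add: linear_conv_bounded_linear)
  then obtain C1 C2 where C: "\<And>z. norm (l1 z) \<le> norm z * C1" "\<And>z. norm (l2 z) \<le> norm z * C2"
    using bounded_linear.bounded by metis
  have "cmod (l1 z) \<le> (\<bar>C1\<bar> + \<bar>C2\<bar>) * norm z" for z
  proof -
    have "norm z * C1 \<le> norm z * (\<bar>C1\<bar> + \<bar>C2\<bar>)" by (intro mult_left_mono) auto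
    then show ?thesis using C(1)[of z] by (simp add: mult.commute)
  qed
  moreover have "cmod (l2 z) \<le> (\<bar>C1\<bar> + \<bar>C2\<bar>) * norm z" for z
  proof -
    have "norm z * C2 \<le> norm z * (\<bar>C1\<bar> + \<bar>C2\<bar>)" by (intro mult_left_mono) auto
    then show ?thesis using C(2)[of z] by (simp add: mult.commute)
  qed
  ultimately show ?thesis using that[of "\<bar>C1\<bar> + \<bar>C2\<bar>"] by simp
qed

lemma l2_A_pow: "cmod (l2 ((A ^^ k) z)) \<le> cmod (l2 z)"
proof (induction k)
  case (Suc k)
  have "cmod al2 * cmod (l2 ((A ^^ k) z)) \<le> 1 * cmod (l2 z)"
    using Suc al by (intro mult_mono) auto
  then show ?case by (simp add: l2_A norm_mult)
qed simp

lemma l1_A_pow: "cmod (l1 ((A ^^ k) z)) \<le> cmod al1 ^ k * cmod (l1 z) + cmod be * real k * cmod (l2 z)"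
proof (induction k)
  case (Suc k)
  let ?w = "(A ^^ k) z"
  have "cmod (l1 ((A ^^ Suc k) z)) \<le> cmod al1 * cmod (l1 ?w) + cmod be * cmod (l2 ?w)"
    using norm_triangle_ineq[of "al1 * l1 ?w" "be * l2 ?w"] by (simp add: l1_A norm_mult)
  also have "\<dots> \<le> cmod al1 * (cmod al1 ^ k * cmod (l1 z) + cmod be * real k * cmod (l2 z)) + cmod be * cmod (l2 z)"
    using Suc l2_A_pow[of k z] by (intro add_mono mult_left_mono) auto
  \<comment> \<open>Either \<open>be\<close> vanishes or \<open>cmod al1\<close> is 1, so the
    accumulated shear term is not magnified.\<close>
  also have "\<dots> = cmod al1 ^ Suc k * cmod (l1 z) + cmod be * real (Suc k) * cmod (l2 z)"
    using be by (auto simp: algebra_simps)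
  finally show ?case .
qed simp

lemma norm_A_pow_le:
  assumes "k < n"
  shows "norm ((A ^^ k) z) \<le> ((1 + cmod be) * (norm u1 + norm u2)) *
    (cmod al1 ^ n * cmod (l1 z) + (real n + 1) * cmod (l2 z))"
proof -
  define x y where "x = cmod (l1 z)" and "y = cmod (l2 z)"
  have xy: "0 \<le> x" "0 \<le> y" by (simp_all add: x_def y_def)
  have "cmod (l1 ((A ^^ k) z)) \<le> cmod al1 ^ k * x + cmod be * real k * y"
    using l1_A_pow by (simp add: x_def y_def)
  also have "\<dots> \<le> cmod al1 ^ n * x + cmod be * (real n + 1) * y"
    using assms al xy by (intro add_mono mult_mono power_increasing) auto
  also have "\<dots> \<le> (1 + cmod be) * (cmod al1 ^ n * x + (real n + 1) * y)"
    using xy by (simp add: algebra_simps)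
  finally have 1: "cmod (l1 ((A ^^ k) z)) \<le> (1 + cmod be) * (cmod al1 ^ n * x + (real n + 1) * y)" .
  have "cmod (l2 ((A ^^ k) z)) \<le> 1 * y"
    using l2_A_pow by (simp add: y_def)
  also have "\<dots> \<le> (1 + cmod be) * (cmod al1 ^ n * x + (real n + 1) * y)"
    using xy by (simp add: algebra_simps)
  finally have 2: "cmod (l2 ((A ^^ k) z)) \<le> (1 + cmod be) * (cmod al1 ^ n * x + (real n + 1) * y)" .
  have "norm ((A ^^ k) z) \<le> cmod (l1 ((A ^^ k) z)) * norm u1 + cmod (l2 ((A ^^ k) z)) * norm u2"
    by (rule norm_le_coords)
  also have "\<dots> \<le> (1 + cmod be) * (cmod al1 ^ n * x + (real n + 1) * y) * norm u1 +
      (1 + cmod be) * (cmod al1 ^ n * x + (real n + 1) * y) * norm u2"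
    using 1 2 by (intro add_mono mult_right_mono) auto
  also have "\<dots> = ((1 + cmod be) * (norm u1 + norm u2)) * (cmod al1 ^ n * x + (real n + 1) * y)"
    by (simp add: algebra_simps)
  finally show ?thesis by (simp add: x_def y_def)
qed

lemma u1_nonzero: "norm u1 > 0"
  using l1_u1 l1_scale[of 0 0] by (cases "u1 = 0") auto

text \<open>Lattice translates bring all points into a bounded region. Two points in a common cell,
  of size \<eta> / \<open>cmod al1 ^ n\<close> in the first coordinate and \<eta> /
  \<open>(n + 1)\<close> in the second, stay within \<open>eps\<close> on the torus for
  \<open>n\<close> steps, so a separated set has at most one point per cell.\<close>

lemma separated_card_le:
  assumes eps: "eps > 0"
  obtains C where "C > 0"
    "\<And>n E. finite E \<Longrightarrow> separated L f n eps E \<Longrightarrow> real (card E) \<le> C * (real n + 1)\<^sup>2 * (cmod al1 ^ 2) ^ n"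
proof -
  obtain R where R: "\<And>z. \<exists>l\<in>L. norm (z - l) \<le> R"
    using lattice4_cocompact[OF L] by blast
  have "0 \<le> R" using R[of 0] norm_ge_zero order_trans by blast
  obtain \<tau> where \<tau>: "\<And>z. \<tau> z \<in> L" "\<And>z. norm (z - \<tau> z) \<le> R"
    using R by metis
  obtain C0 where C0: "C0 \<ge> 0" "\<And>z. cmod (l1 z) \<le> C0 * norm z" "\<And>z. cmod (l2 z) \<le> C0 * norm z"
    using coords_bounded by blast
  define B where "B = C0 * R"
  have "0 \<le> B" using C0(1) \<open>0 \<le> R\<close> by (simp add: B_def)
  have bd: "cmod (l1 (z - \<tau> z)) \<le> B" "cmod (l2 (z - \<tau> z)) \<le> B" for z
    using C0(2,3)[of "z - \<tau> z"] mult_left_mono[OF \<tau>(2)[of z] C0(1)] by (auto simp: B_def)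
  define M where "M = (1 + cmod be) * (norm u1 + norm u2)"
  have "M > 0" using u1_nonzero by (auto simp: M_def intro!: mult_pos_pos add_pos_nonneg)
  \<comment> \<open>Each coordinate may differ by twice the mesh, which adds up to
    \<open>4 * M\<close> times \<eta>, exactly \<open>eps\<close>; separation asks for strictly
    more.\<close>
  define \<eta> where "\<eta> = eps / (4 * M)"
  have "\<eta> > 0" using eps \<open>M > 0\<close> by (simp add: \<eta>_def)
  define K where "K = 2 * B / \<eta> + 3"
  have "K \<ge> 3" using \<open>0 \<le> B\<close> \<open>\<eta> > 0\<close> by (simp add: K_def)
  have bound: "real (card E) \<le> K ^ 4 * (real n + 1)\<^sup>2 * (cmod al1 ^ 2) ^ n"
    if fin: "finite E" and sep: "separated L f n eps E" for n E
  proof -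
    define s1 s2 where "s1 = \<eta> / cmod al1 ^ n" and "s2 = \<eta> / (real n + 1)"
    have a: "1 \<le> cmod al1 ^ n" using al(1) by simp
    then have "0 < cmod al1 ^ n" by linarith
    have s: "s1 > 0" "s2 > 0" using \<open>\<eta> > 0\<close> \<open>0 < cmod al1 ^ n\<close> by (auto simp: s1_def s2_def intro!: divide_pos_pos)
    have inj: "x = y" if x: "x \<in> E" and y: "y \<in> E"
      and d1: "cmod (l1 (x - \<tau> x) - l1 (y - \<tau> y)) \<le> 2 * s1"
      and d2: "cmod (l2 (x - \<tau> x) - l2 (y - \<tau> y)) \<le> 2 * s2" for x y
    proof (rule ccontr)
      assume "x \<noteq> y"
      then obtain k where k: "k < n" "tdist L ((f ^^ k) x) ((f ^^ k) y) > eps"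
        using sep x y unfolding separated_def by blast
      define z where "z = (x - \<tau> x) - (y - \<tau> y)"
      have z1: "cmod (l1 z) \<le> 2 * s1" and z2: "cmod (l2 z) \<le> 2 * s2"
        using d1 d2 by (simp_all add: z_def l1_diff l2_diff)
      \<comment> \<open>Changing representatives alters the difference of the orbits at time
        \<open>k\<close> by a lattice vector, which \<open>tdist\<close> does not see.\<close>
      have "(A ^^ k) (\<tau> x - \<tau> y) \<in> L"
        using \<tau>(1) by (intro A_pow_L lattice4_diff[OF L])
      then have "tdist L ((f ^^ k) x) ((f ^^ k) y) \<le> norm ((f ^^ k) x - (f ^^ k) y - (A ^^ k) (\<tau> x - \<tau> y))"
        by (rule tdist_le)
      also have "(f ^^ k) x - (f ^^ k) y - (A ^^ k) (\<tau> x - \<tau> y) = (A ^^ k) z"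
        unfolding f_pow_diff z_def by (simp add: A_pow_diff)
      also have "norm ((A ^^ k) z) \<le> M * (cmod al1 ^ n * cmod (l1 z) + (real n + 1) * cmod (l2 z))"
        unfolding M_def by (rule norm_A_pow_le[OF k(1)])
      also have "\<dots> \<le> M * (cmod al1 ^ n * (2 * s1) + (real n + 1) * (2 * s2))"
        using z1 z2 \<open>M > 0\<close> by (intro mult_left_mono add_mono) auto
      also have "\<dots> = M * (2 * \<eta> + 2 * \<eta>)"
        using al(1) by (auto simp: s1_def s2_def)
      also have "\<dots> = eps" using \<open>M > 0\<close> by (simp add: \<eta>_def)
      finally show False using k(2) by simp
    qed
    have "real (card E) \<le> (2 * B / s1 + 3)\<^sup>2 * (2 * B / s2 + 3)\<^sup>2"
      by (rule card_le_grid[OF fin s \<open>0 \<le> B\<close> bd inj])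
    also have "\<dots> \<le> (K * cmod al1 ^ n)\<^sup>2 * (K * (real n + 1))\<^sup>2"
    proof (intro mult_mono power_mono)
      show "2 * B / s1 + 3 \<le> K * cmod al1 ^ n"
        using a by (simp add: s1_def K_def algebra_simps)
      show "2 * B / s2 + 3 \<le> K * (real n + 1)"
        by (simp add: s2_def K_def algebra_simps)
    qed (use \<open>0 \<le> B\<close> s in auto)
    also have "\<dots> = K ^ 4 * (real n + 1)\<^sup>2 * (cmod al1 ^ 2) ^ n"
      by (simp add: power_mult_distrib power_mult[symmetric] mult.commute[of n] eval_nat_numeral)
    finally show ?thesis .
  qed
  show ?thesis by (rule that[of "K ^ 4"]) (use \<open>K \<ge> 3\<close> bound in auto)
qed

text \<open>A real supremum is informative only over a nonempty bounded set. The empty separated set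
  and the counting bound guarantee this, so \<open>max_sep\<close> does dominate every
  cardinality.\<close>

lemma max_sep_bounds:
  assumes "eps > 0"
  obtains C where "C > 0" "\<And>n. max_sep L f n eps \<le> C * (real n + 1)\<^sup>2 * (cmod al1 ^ 2) ^ n"
    "\<And>n E. finite E \<Longrightarrow> separated L f n eps E \<Longrightarrow> real (card E) \<le> max_sep L f n eps"
proof -
  obtain C where C: "C > 0"
    "\<And>n E. finite E \<Longrightarrow> separated L f n eps E \<Longrightarrow> real (card E) \<le> C * (real n + 1)\<^sup>2 * (cmod al1 ^ 2) ^ n"
    using separated_card_le[OF assms] by blast
  have bdd: "bdd_above {real (card E) | E. finite E \<and> separated L f n eps E}" for n
    using C(2) by (intro bdd_aboveI[of _ "C * (real n + 1)\<^sup>2 * (cmod al1 ^ 2) ^ n"]) blast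
  have "max_sep L f n eps \<le> C * (real n + 1)\<^sup>2 * (cmod al1 ^ 2) ^ n" for n
    unfolding max_sep_def
  proof (rule cSup_least)
    have "finite {} \<and> separated L f n eps {}" by (simp add: separated_def)
    then show "{real (card E) | E. finite E \<and> separated L f n eps E} \<noteq> {}" by blast
  qed (use C(2) in blast)
  moreover have "real (card E) \<le> max_sep L f n eps" if "finite E" "separated L f n eps E" for n E
    unfolding max_sep_def using that by (intro cSup_upper bdd) blast
  ultimately show ?thesis using that[OF C(1)] by blast
qed

text \<open>The factor \<open>C * (n + 1)^2\<close> disappears after taking logarithms and dividing
  by \<open>n\<close>. For \<open>cmod al1 = 1\<close> the bound is 0, which is how positive entropy
  later excludes that case.\<close>

lemma top_entropy_le: "top_entropy L f \<le> ereal (ln (cmod al1 ^ 2))"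
  unfolding top_entropy_def
proof (rule SUP_least)
  fix eps :: real assume "eps \<in> {0<..}"
  then obtain C where C: "C > 0" "\<And>n. max_sep L f n eps \<le> C * (real n + 1)\<^sup>2 * (cmod al1 ^ 2) ^ n"
    "\<And>n E. finite E \<Longrightarrow> separated L f n eps E \<Longrightarrow> real (card E) \<le> max_sep L f n eps"
    using max_sep_bounds[of eps] by auto
  have ge1: "1 \<le> max_sep L f n eps" for n
    using C(3)[of "{0}" n] by (simp add: separated_def)
  have a: "cmod al1 ^ 2 > 0" using al by auto
  define h where "h = ln (cmod al1 ^ 2)"
  have le: "ln (max_sep L f n eps) / real n \<le> (ln C + 2 * ln (real n + 1)) / real n + h" if "n > 0" for n
  proof -
    have "ln (max_sep L f n eps) \<le> ln (C * (real n + 1)\<^sup>2 * (cmod al1 ^ 2) ^ n)"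
      using C(2)[of n] ge1[of n] by (intro ln_mono) auto
    also have "\<dots> = ln C + 2 * ln (real n + 1) + real n * h"
      using C(1) a by (simp add: ln_mult ln_realpow h_def)
    finally show ?thesis using that by (simp add: field_simps)
  qed
  have "limsup (\<lambda>n. ereal (ln (max_sep L f n eps) / real n))
      \<le> limsup (\<lambda>n. ereal ((ln C + 2 * ln (real n + 1)) / real n + h))"
    using le by (intro Limsup_mono eventually_mono[OF eventually_gt_at_top[of 0]]) auto
  also have "(\<lambda>n. (ln C + 2 * ln (real n + 1)) / real n + h) \<longlonglongrightarrow> h"
    by real_asymp
  then have "limsup (\<lambda>n. ereal ((ln C + 2 * ln (real n + 1)) / real n + h)) = ereal h"
    by (intro lim_imp_Limsup) auto
  finally show "limsup (\<lambda>n. ereal (ln (max_sep L f n eps) / real n)) \<le> ereal (ln (cmod al1 ^ 2))"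
    by (simp add: h_def)
qed

section \<open>Separated sets in the expanding eigenline\<close>

lemma A_u1: "A (c *s u1) = (al1 * c) *s u1"
proof -
  have "A u1 = al1 *s u1"
    using coords[of "A u1"] by (simp add: l1_A l2_A l1_u1 l2_u1)
  then show ?thesis using A by (simp add: complex_linear2_def vector_smult_assoc mult.commute)
qed

lemma A_pow_u1: "(A ^^ k) (c *s u1) = (al1 ^ k * c) *s u1"
  by (induction k) (simp_all add: A_u1 mult.assoc)

text \<open>The witness is a square grid in the expanding eigenline, of mesh comparable to
  \<open>eps / |al1|^n\<close>; a pair of its points is separated at the first time its distance exceeds
  \<open>eps\<close>, when that distance is still too small to be shortened by a lattice vector.\<close>

lemma exists_separated_grid:
  assumes gt: "cmod al1 > 1"
  obtains eps where "eps > 0"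
    "\<And>n. n > 0 \<Longrightarrow> \<exists>E. finite E \<and> separated L f n eps E \<and> (cmod al1 ^ 2) ^ n / 16 \<le> real (card E)"
proof -
  obtain \<rho> where \<rho>: "\<rho> > 0" "\<And>l. l \<in> L \<Longrightarrow> l \<noteq> 0 \<Longrightarrow> \<rho> \<le> norm l"
    using lattice4_discrete[OF L] by blast
  define a w where "a = cmod al1" and "w = norm u1"
  have "a > 1" "w > 0" using gt u1_nonzero by (simp_all add: a_def w_def)
  \<comment> \<open>A distance that has just passed \<open>eps\<close> is at most
    \<open>a * eps\<close>. Since \<open>(a + 1) * eps\<close> is below \<rho>, shifting by a
    nonzero lattice vector still leaves a distance above \<open>eps\<close>.\<close>
  define eps where "eps = \<rho> / (2 * (a + 1))"
  have "a * eps + eps = (a + 1) * eps" by (simp add: algebra_simps)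
  also have "\<dots> = \<rho> / 2" using \<open>a > 1\<close> by (simp add: eps_def field_simps)
  finally have "a * eps + eps < \<rho>"
    using \<rho>(1) by linarith
  moreover have "eps > 0"
    using \<rho>(1) \<open>a > 1\<close> by (simp add: eps_def)
  ultimately have eps: "eps > 0" "a * eps + eps < \<rho>" by simp_all
  have "\<exists>E. finite E \<and> separated L f n eps E \<and> (cmod al1 ^ 2) ^ n / 16 \<le> real (card E)"
    if n: "n > 0" for n
  proof -
    \<comment> \<open>The mesh \<open>d\<close> puts neighbours \<open>2 * eps\<close> apart at the
      last admissible time \<open>n - 1\<close>. The side \<open>N\<close> keeps the initial
      diameter at most \<open>a * eps\<close>, while \<open>(N + 1)^2\<close> is still at least
      \<open>a ^ (2 * n) / 16\<close>.\<close>
    define N where "N = nat \<lfloor>a ^ n / 4\<rfloor>"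
    define d where "d = 2 * eps / (w * a ^ (n - 1))"
    have "a ^ n > 0" "a ^ (n - 1) > 0" using \<open>a > 1\<close> by simp_all
    then have "d > 0" using eps \<open>w > 0\<close> by (simp add: d_def)
    have "0 \<le> a ^ n / 4" using \<open>a ^ n > 0\<close> by simp
    then have N_real: "real N = of_int \<lfloor>a ^ n / 4\<rfloor>" unfolding N_def by simp
    have "a ^ n / 4 < real N + 1" "real N \<le> a ^ n / 4"
      unfolding N_real by (rule real_of_int_floor_add_one_gt, rule of_int_floor_le)
    then have N: "4 * real N \<le> a ^ n" "a ^ n \<le> 4 * (real N + 1)"
      by simp_all
    define pt where "pt = (\<lambda>(i :: nat, j :: nat). of_real d * Complex (real i) (real j))"
    define E where "E = (\<lambda>q. pt q *s u1) ` ({..N} \<times> {..N})"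
    have pt_far: "d \<le> cmod (pt q - pt r)" if "q \<noteq> r" for q r
    proof -
      obtain i j i' j' where qr: "q = (i, j)" "r = (i', j')" by (cases q, cases r) auto
      have "pt q - pt r = of_real d * Complex (real i - real i') (real j - real j')"
        by (simp add: pt_def qr complex_eq_iff algebra_simps)
      then have eq: "cmod (pt q - pt r) = d * cmod (Complex (real i - real i') (real j - real j'))"
        using \<open>d > 0\<close> by (simp add: norm_mult)
      have "1 \<le> \<bar>real i - real i'\<bar> \<or> 1 \<le> \<bar>real j - real j'\<bar>"
        using that by (auto simp: qr)
      then have "1 \<le> cmod (Complex (real i - real i') (real j - real j'))"
        using abs_Re_le_cmod[of "Complex (real i - real i') (real j - real j')"]
          abs_Im_le_cmod[of "Complex (real i - real i') (real j - real j')"] by auto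
      then have "d * 1 \<le> d * cmod (Complex (real i - real i') (real j - real j'))"
        using \<open>d > 0\<close> by (intro mult_left_mono) auto
      then show ?thesis using eq by simp
    qed
    have pt_near: "cmod (pt q - pt r) \<le> d * (2 * real N)" if "q \<in> {..N} \<times> {..N}" "r \<in> {..N} \<times> {..N}" for q r
    proof -
      obtain i j i' j' where qr: "q = (i, j)" "r = (i', j')" by (cases q, cases r) auto
      have "pt q - pt r = of_real d * Complex (real i - real i') (real j - real j')"
        by (simp add: pt_def qr complex_eq_iff algebra_simps)
      then have eq: "cmod (pt q - pt r) = d * cmod (Complex (real i - real i') (real j - real j'))"
        using \<open>d > 0\<close> by (simp add: norm_mult)
      have "cmod (Complex (real i - real i') (real j - real j')) \<le> \<bar>real i - real i'\<bar> + \<bar>real j - real j'\<bar>"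
        using cmod_le[of "Complex (real i - real i') (real j - real j')"] by simp
      also have "\<dots> \<le> 2 * real N" using that by (auto simp: qr)
      finally show ?thesis unfolding eq using \<open>d > 0\<close> by (intro mult_left_mono) auto
    qed
    have "inj_on (\<lambda>q. pt q *s u1) ({..N} \<times> {..N})"
    proof (rule inj_onI)
      fix q r assume "pt q *s u1 = pt r *s u1"
      then have "l1 (pt q *s u1) = l1 (pt r *s u1)" by (rule arg_cong)
      then have "pt q = pt r" by (simp add: l1_scale l1_u1)
      then show "q = r" using pt_far[of q r] \<open>d > 0\<close> by (cases "q = r") auto
    qed
    then have "card E = (N + 1) * (N + 1)"
      unfolding E_def by (simp add: card_image card_cartesian_product)
    moreover have "(a ^ 2) ^ n / 16 \<le> real ((N + 1) * (N + 1))"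
    proof -
      have "a ^ n * a ^ n \<le> (4 * (real N + 1)) * (4 * (real N + 1))"
        using N(2) \<open>a ^ n > 0\<close> by (intro mult_mono) auto
      moreover have "(a ^ 2) ^ n = a ^ n * a ^ n"
        by (simp add: power2_eq_square power_mult_distrib)
      ultimately show ?thesis by (simp add: algebra_simps)
    qed
    moreover have "separated L f n eps E"
      unfolding separated_def
    proof (intro ballI impI)
      fix x y assume "x \<in> E" "y \<in> E" "x \<noteq> y"
      then obtain q r where qr: "x = pt q *s u1" "y = pt r *s u1" "q \<in> {..N} \<times> {..N}" "r \<in> {..N} \<times> {..N}" "q \<noteq> r"
        by (auto simp: E_def)
      define D where "D = cmod (pt q - pt r) * w"
      have norm_pow: "norm ((A ^^ k) (x - y)) = a ^ k * D" for k
      proof -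
        have xy: "x - y = (pt q - pt r) *s u1" by (simp add: qr vector_sub_rdistrib)
        show ?thesis unfolding xy A_pow_u1 norm_smult by (simp add: norm_mult norm_power D_def a_def w_def)
      qed
      have D_le: "D \<le> a * eps"
      proof -
        have "D \<le> d * (2 * real N) * w"
          unfolding D_def using pt_near[OF qr(3,4)] \<open>w > 0\<close> by (intro mult_right_mono) auto
        also have "\<dots> = 4 * real N * eps / a ^ (n - 1)"
          using \<open>w > 0\<close> by (simp add: d_def field_simps)
        also have "\<dots> \<le> a ^ n * eps / a ^ (n - 1)"
          using N(1) eps(1) \<open>a ^ (n - 1) > 0\<close> by (intro divide_right_mono mult_right_mono) auto
        also have "\<dots> = a * eps"
          using n \<open>a ^ (n - 1) > 0\<close> by (cases n) auto
        finally show ?thesis .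
      qed
      have ex: "a ^ (n - 1) * D > eps"
      proof -
        have "d * w \<le> D" unfolding D_def using pt_far[OF qr(5)] \<open>w > 0\<close> by (intro mult_right_mono) auto
        then have "a ^ (n - 1) * (d * w) \<le> a ^ (n - 1) * D"
          using \<open>a ^ (n - 1) > 0\<close> by (intro mult_left_mono) auto
        moreover have "a ^ (n - 1) * (d * w) = 2 * eps"
          using \<open>a > 1\<close> \<open>w > 0\<close> by (simp add: d_def)
        ultimately show ?thesis using eps(1) by simp
      qed
      define k where "k = (LEAST k. a ^ k * D > eps)"
      have k: "a ^ k * D > eps" "k \<le> n - 1"
        unfolding k_def by (rule LeastI[of "\<lambda>k. a ^ k * D > eps", OF ex], rule Least_le[of "\<lambda>k. a ^ k * D > eps", OF ex])
      have k_le: "a ^ k * D \<le> a * eps"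
      proof (cases k)
        case 0
        then show ?thesis using D_le by simp
      next
        case (Suc j)
        then have "\<not> a ^ j * D > eps"
          using not_less_Least[of j "\<lambda>k. a ^ k * D > eps"] by (simp add: k_def)
        then have "a * (a ^ j * D) \<le> a * eps" using \<open>a > 1\<close> by (intro mult_left_mono) auto
        then show ?thesis by (simp add: Suc mult.assoc)
      qed
      \<comment> \<open>The lattice vector 0 gives the first entry; all others have length at least
        \<rho> and give the second.\<close>
      have "min (a ^ k * D) (\<rho> - a ^ k * D) \<le> tdist L ((f ^^ k) x) ((f ^^ k) y)"
      proof (rule tdist_ge[OF L])
        fix l assume "l \<in> L"
        have *: "(f ^^ k) x - (f ^^ k) y - l = (A ^^ k) (x - y) - l"
          by (simp add: f_pow_diff)
        show "min (a ^ k * D) (\<rho> - a ^ k * D) \<le> norm ((f ^^ k) x - (f ^^ k) y - l)"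
        proof (cases "l = 0")
          case True
          then show ?thesis unfolding * by (simp add: norm_pow)
        next
          case False
          then have "\<rho> \<le> norm l" using \<rho>(2) \<open>l \<in> L\<close> by blast
          then have "\<rho> - a ^ k * D \<le> norm ((A ^^ k) (x - y) - l)"
            using norm_triangle_ineq2[of l "(A ^^ k) (x - y)"] norm_pow[of k] by (simp add: norm_minus_commute)
          then show ?thesis unfolding * by simp
        qed
      qed
      moreover have "eps < min (a ^ k * D) (\<rho> - a ^ k * D)"
        using k(1) k_le eps(2) by simp
      ultimately show "\<exists>k<n. tdist L ((f ^^ k) x) ((f ^^ k) y) > eps"
        using k(2) n by (intro exI[of _ k]) auto
    qed
    ultimately show ?thesis
      by (intro exI[of _ E]) (auto simp: E_def a_def)
  qed
  then show ?thesis using that eps(1) by blast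
qed

text \<open>A single \<open>eps\<close> suffices below, because the entropy is a supremum over
  \<open>eps\<close>; the factor 16 lost in the count vanishes in the limit.\<close>

lemma top_entropy_eq:
  assumes gt: "cmod al1 > 1"
  shows "top_entropy L f = ereal (ln (cmod al1 ^ 2))"
proof (rule antisym[OF top_entropy_le])
  obtain eps where eps: "eps > 0"
    and ex: "\<And>n. n > 0 \<Longrightarrow> \<exists>E. finite E \<and> separated L f n eps E \<and> (cmod al1 ^ 2) ^ n / 16 \<le> real (card E)"
    using exists_separated_grid[OF gt] by blast
  obtain C where C: "\<And>n E. finite E \<Longrightarrow> separated L f n eps E \<Longrightarrow> real (card E) \<le> max_sep L f n eps"
    using max_sep_bounds[OF eps] by metis
  define h where "h = ln (cmod al1 ^ 2)"
  have a: "cmod al1 ^ 2 > 0" using gt by auto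
  have le: "- ln 16 / real n + h \<le> ln (max_sep L f n eps) / real n" if "n > 0" for n
  proof -
    have le: "(cmod al1 ^ 2) ^ n / 16 \<le> max_sep L f n eps"
      using ex[OF that] C[of _ n] by (meson order_trans)
    have "real n * h - ln 16 = ln ((cmod al1 ^ 2) ^ n / 16)"
      using a by (subst ln_div) (auto simp: ln_realpow h_def)
    also have "\<dots> \<le> ln (max_sep L f n eps)"
      using le a by (intro ln_mono) auto
    finally have "(real n * h - ln 16) / real n \<le> ln (max_sep L f n eps) / real n"
      by (intro divide_right_mono) auto
    then show ?thesis using that by (simp add: diff_divide_distrib)
  qed
  have "(\<lambda>n. - ln 16 / real n + h) \<longlonglongrightarrow> h"
    by real_asymp
  then have "ereal h = limsup (\<lambda>n. ereal (- ln 16 / real n + h))"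
    by (intro lim_imp_Limsup[symmetric]) auto
  also have "\<dots> \<le> limsup (\<lambda>n. ereal (ln (max_sep L f n eps) / real n))"
    using le by (intro Limsup_mono eventually_mono[OF eventually_gt_at_top[of 0]]) auto
  also have "\<dots> \<le> top_entropy L f"
    unfolding top_entropy_def using eps by (intro SUP_upper) auto
  finally show "ereal (ln (cmod al1 ^ 2)) \<le> top_entropy L f" by (simp add: h_def)
qed

end

section \<open>The characteristic polynomial on the lattice\<close>

lemma sign_cases: "sign p = 1 \<or> sign p = -1"
  by (simp add: sign_def)

text \<open>The determinant is an integer polynomial in the entries. The instance in view is
  evaluation of a matrix of integer polynomials at a complex number.\<close>

lemma det_ring_hom:
  fixes h :: "'a::comm_ring_1 \<Rightarrow> 'b::comm_ring_1" and X :: "'a ^ 'n ^ 'n"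
  assumes add: "\<And>x y. h (x + y) = h x + h y" and mult: "\<And>x y. h (x * y) = h x * h y"
    and one: "h 1 = 1"
  shows "det (\<chi> i j. h (X $ i $ j)) = h (det X)"
proof -
  have zero: "h 0 = 0" using add[of 0 0] by simp
  have neg: "h (- x) = - h x" for x
    using add[of x "- x"] zero by (simp add: eq_neg_iff_add_eq_0 add.commute)
  have sums: "h (sum g S) = (\<Sum>x\<in>S. h (g x))" for g :: "('n \<Rightarrow> 'n) \<Rightarrow> 'a" and S
    by (induction S rule: infinite_finite_induct) (simp_all add: zero add)
  have prods: "h (prod g S) = (\<Prod>x\<in>S. h (g x))" for g :: "'n \<Rightarrow> 'a" and S
    by (induction S rule: infinite_finite_induct) (simp_all add: one mult)
  have sgn: "h (of_int (sign p)) = of_int (sign p)" for p :: "'n \<Rightarrow> 'n"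
    using sign_cases[of p] by (auto simp: one neg)
  show ?thesis
    unfolding det_def by (simp add: sums mult prods sgn)
qed

text \<open>In the index type the numeral \<open>4\<close> denotes \<open>0\<close>, so the order is \<open>4 < 1 < 2 < 3\<close>.\<close>

lemma less_4_cases:
  fixes i j :: 4
  assumes "j < i"
  shows "i = 1 \<and> j = 4 \<or> i = 2 \<and> (j = 4 \<or> j = 1) \<or> i = 3 \<and> (j = 4 \<or> j = 1 \<or> j = 2)"
  using assms exhaust_4[of i] exhaust_4[of j]
  by (auto simp: less_bit0_def bit0.Rep_numeral bit0.Rep_1 bit0.Rep_0)

text \<open>The functionals \<open>l2, cnj l2, l1, cnj l1\<close>, in this order, triangularize the integer matrix
  of \<open>A\<close> with respect to a lattice basis.\<close>

lemma lattice_char_poly: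
  fixes l1 l2 :: "complex ^ 2 \<Rightarrow> complex"
  assumes L: "lattice4 L" and A: "complex_linear2 A" and A_L: "\<And>l. l \<in> L \<Longrightarrow> A l \<in> L"
    and l1_add: "\<And>x y. l1 (x + y) = l1 x + l1 y" and l1_scale: "\<And>c x. l1 (c *s x) = c * l1 x"
    and l2_add: "\<And>x y. l2 (x + y) = l2 x + l2 y" and l2_scale: "\<And>c x. l2 (c *s x) = c * l2 x"
    and l1_u1: "l1 u1 = 1" and l2_u1: "l2 u1 = 0" and l1_u2: "l1 u2 = 0" and l2_u2: "l2 u2 = 1"
    and l1_A: "\<And>z. l1 (A z) = al1 * l1 z + be * l2 z"
    and l2_A: "\<And>z. l2 (A z) = al2 * l2 z"
  obtains p :: "int poly" where
    "\<And>t :: complex. ipoly p t = (t - al1) * (t - cnj al1) * (t - al2) * (t - cnj al2)"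
proof -
  obtain v :: "4 \<Rightarrow> complex ^ 2" where v: "inj v" "independent (range v)"
    and L_I: "\<And>n :: 4 \<Rightarrow> int. (\<Sum>i\<in>UNIV. real_of_int (n i) *\<^sub>R v i) \<in> L"
    and L_E: "\<And>l. l \<in> L \<Longrightarrow> \<exists>n :: 4 \<Rightarrow> int. l = (\<Sum>i\<in>UNIV. real_of_int (n i) *\<^sub>R v i)"
    using L by (rule lattice4E) (rule that)
  have v_L: "v i \<in> L" for i
  proof -
    have "(\<Sum>j\<in>UNIV. real_of_int (if j = i then 1 else 0) *\<^sub>R v j) = (\<Sum>j\<in>UNIV. if j = i then v j else 0)"
      by (intro sum.cong) auto
    also have "\<dots> = v i" by simp
    finally show ?thesis using L_I[of "\<lambda>j. if j = i then 1 else 0"] by simp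
  qed
  have "\<forall>i. \<exists>n. A (v i) = (\<Sum>j\<in>UNIV. real_of_int (n j) *\<^sub>R v j)"
    using L_E[OF A_L[OF v_L]] by blast
  then obtain M where M: "\<And>i. A (v i) = (\<Sum>j\<in>UNIV. real_of_int (M i j) *\<^sub>R v j)"
    by metis
  define \<psi> :: "4 \<Rightarrow> complex ^ 2 \<Rightarrow> complex" where
    "\<psi> k = (if k = 4 then l2 else if k = 1 then cnj \<circ> l2 else if k = 2 then l1 else cnj \<circ> l1)" for k
  have \<psi>: "\<psi> 4 = l2" "\<psi> 1 = cnj \<circ> l2" "\<psi> 2 = l1" "\<psi> 3 = cnj \<circ> l1"
    by (simp_all add: \<psi>_def)
  have \<psi>_add: "\<psi> k (x + y) = \<psi> k x + \<psi> k y" for k x y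
    by (simp add: \<psi>_def l1_add l2_add)
  have \<psi>_scale: "\<psi> k (r *\<^sub>R x) = of_real r * \<psi> k x" for k r x
    by (simp add: \<psi>_def scaleR_eq_smult l1_scale l2_scale)
  have \<psi>_zero: "\<psi> k 0 = 0" for k
    using \<psi>_scale[of k 0 0] by simp
  have \<psi>_sum: "\<psi> k (\<Sum>j\<in>UNIV. r j *\<^sub>R v j) = (\<Sum>j\<in>UNIV. of_real (r j) * \<psi> k (v j))" for k r
  proof -
    have "\<psi> k (\<Sum>j\<in>S. r j *\<^sub>R v j) = (\<Sum>j\<in>S. of_real (r j) * \<psi> k (v j))" for S
      by (induction S rule: infinite_finite_induct) (simp_all add: \<psi>_zero \<psi>_add \<psi>_scale)
    then show ?thesis .
  qed
  define W :: "complex ^ 4 ^ 4" where "W = (\<chi> i k. \<psi> k (v i))"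
  \<comment> \<open>Column \<open>k\<close> expands the composite of \<psi> \<open>k\<close> with
    \<open>A\<close> in the four functionals. The off-diagonal entries couple \<open>l1\<close> to
    \<open>l2\<close> and \<open>cnj l1\<close> to \<open>cnj l2\<close>; the chosen order puts them
    above the diagonal.\<close>
  define D :: "complex ^ 4 ^ 4" where "D = (\<chi> m k.
    if m = k then (if k = 4 then al2 else if k = 1 then cnj al2 else if k = 2 then al1 else cnj al1)
    else if m = 4 \<and> k = 2 then be else if m = 1 \<and> k = 3 then cnj be else 0)"
  define MC :: "complex ^ 4 ^ 4" where "MC = (\<chi> i j. of_int (M i j))"
  have MW: "(\<Sum>j\<in>UNIV. MC $ i $ j * W $ j $ k) = (\<Sum>m\<in>UNIV. W $ i $ m * D $ m $ k)" for i k
  proof -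
    have "(\<Sum>j\<in>UNIV. MC $ i $ j * W $ j $ k) = \<psi> k (A (v i))"
      unfolding M \<psi>_sum by (simp add: MC_def W_def)
    also have "\<dots> = (\<Sum>m\<in>UNIV. \<psi> m (v i) * D $ m $ k)"
      using exhaust_4[of k] unfolding sum_4
      by (elim disjE) (simp_all add: D_def \<psi> l1_A l2_A)
    finally show ?thesis by (simp add: W_def)
  qed
  \<comment> \<open>A kernel vector is a combination of the functionals that vanishes on a real
    basis, hence everywhere. Its values at \<open>u\<close> and at \<open>\<i> *s u\<close> separate
    a functional from its conjugate.\<close>
  have "det W \<noteq> 0"
  proof -
    have "x = 0" if "W *v x = 0" for x
    proof -
      define \<phi> where "\<phi> z = (\<Sum>k\<in>UNIV. \<psi> k z * x $ k)" for z
      have \<phi>_v: "\<phi> (v i) = 0" for i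
        using that by (simp add: \<phi>_def W_def matrix_vector_mult_def vec_eq_iff)
      have \<phi>_sum: "\<phi> (\<Sum>j\<in>UNIV. r j *\<^sub>R v j) = (\<Sum>j\<in>UNIV. of_real (r j) * \<phi> (v j))" for r
        unfolding \<phi>_def \<psi>_sum sum_distrib_right sum_distrib_left
        by (subst sum.swap) (simp add: mult.assoc)
      have \<phi>_0: "\<phi> z = 0" for z
      proof -
        obtain r where z: "z = (\<Sum>j\<in>UNIV. r j *\<^sub>R v j)"
          using basis4_span[OF v] by blast
        show ?thesis unfolding z \<phi>_sum by (simp add: \<phi>_v)
      qed
      have \<phi>_eq: "\<phi> z = cnj (l2 z) * x $ 1 + l1 z * x $ 2 + cnj (l1 z) * x $ 3 + l2 z * x $ 4" for z
        by (simp add: \<phi>_def sum_4 \<psi>)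
      have *: "a = 0 \<and> b = 0" if "a + b = 0" "\<i> * a - \<i> * b = 0" for a b :: complex
      proof -
        have "a = b" using that(2) by simp
        then show ?thesis using that(1) by simp
      qed
      have "x $ 2 + x $ 3 = 0" "\<i> * x $ 2 - \<i> * x $ 3 = 0"
        using \<phi>_0[of u1] \<phi>_0[of "\<i> *s u1"]
        by (simp_all add: \<phi>_eq l1_scale l2_scale l1_u1 l2_u1)
      then have x23: "x $ 2 = 0 \<and> x $ 3 = 0" by (rule *)
      have "x $ 4 + x $ 1 = 0" "\<i> * x $ 4 - \<i> * x $ 1 = 0"
        using \<phi>_0[of u2] \<phi>_0[of "\<i> *s u2"]
        by (simp_all add: \<phi>_eq l1_scale l2_scale l1_u2 l2_u2 add.commute)
      then have "x $ 4 = 0 \<and> x $ 1 = 0" by (rule *)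
      then show "x = 0" using x23 by (simp add: vec_eq_iff forall_4)
    qed
    then have "\<exists>B. B ** W = mat 1"
      by (subst matrix_left_invertible_ker) blast
    then have "invertible W" by (simp add: invertible_left_inverse)
    then show ?thesis by (simp add: invertible_det_nz)
  qed
  \<comment> \<open>Forming the determinant over integer polynomials makes the integrality of the
    coefficients automatic.\<close>
  define p where "p = det (\<chi> i j. [:- M i j, if i = j then 1 else 0:])"
  have "ipoly p t = (t - al1) * (t - cnj al1) * (t - al2) * (t - cnj al2)" for t :: complex
  proof -
    define TM TD :: "complex ^ 4 ^ 4" where
      "TM = (\<chi> i j. (if i = j then t else 0) - MC $ i $ j)" and
      "TD = (\<chi> i j. (if i = j then t else 0) - D $ i $ j)"
    have "ipoly p t = det (\<chi> i j. ipoly ((\<chi> i j. [:- M i j, if i = j then 1 else 0:]) $ i $ j) t)"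
      unfolding p_def
      by (rule det_ring_hom[symmetric]) (simp_all add: map_poly_of_int_add map_poly_of_int_mult)
    also have "\<dots> = det TM"
      by (rule arg_cong[where f = det]) (simp add: TM_def MC_def vec_eq_iff map_poly_pCons)
    finally have p_TM: "ipoly p t = det TM" .
    have diag1: "(\<Sum>j\<in>UNIV. (if i = j then t else 0) * g j) = t * g i" for i :: 4 and g
    proof -
      have "(\<Sum>j\<in>UNIV. (if i = j then t else 0) * g j) = (\<Sum>j\<in>UNIV. if i = j then t * g j else 0)"
        by (intro sum.cong) auto
      then show ?thesis by simp
    qed
    have diag2: "(\<Sum>j\<in>UNIV. g j * (if j = k then t else 0)) = t * g k" for k :: 4 and g
    proof -
      have "(\<Sum>j\<in>UNIV. g j * (if j = k then t else 0)) = (\<Sum>j\<in>UNIV. if j = k then t * g j else 0)"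
        by (intro sum.cong) auto
      then show ?thesis by simp
    qed
    have "TM ** W = W ** TD"
      by (simp add: vec_eq_iff matrix_matrix_mult_def TM_def TD_def left_diff_distrib
          right_diff_distrib sum_subtractf diag1 diag2 MW)
    then have "det (TM ** W) = det (W ** TD)" by (rule arg_cong)
    then have "det TM * det W = det W * det TD" unfolding det_mul .
    then have "det TM = det TD" using \<open>det W \<noteq> 0\<close> by simp
    also have "det TD = (\<Prod>i\<in>UNIV. TD $ i $ i)"
      by (rule det_upperdiagonal) (auto simp: TD_def D_def dest!: less_4_cases)
    also have "\<dots> = (t - al1) * (t - cnj al1) * (t - al2) * (t - cnj al2)"
      unfolding UNIV_4 by (simp add: TD_def D_def)
    finally show ?thesis unfolding p_TM .
  qed
  then show ?thesis using that by blast
qed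

lemma lattice_char_coeffs:
  fixes x1 x2 x3 x4 :: complex
  assumes "\<And>t. ipoly p t = (t - x1) * (t - x2) * (t - x3) * (t - x4)"
  obtains a b c d :: int where "of_int a = x1 + x2 + x3 + x4"
    "of_int b = x1 * x2 + x1 * x3 + x1 * x4 + x2 * x3 + x2 * x4 + x3 * x4"
    "of_int c = x1 * x2 * x3 + x1 * x2 * x4 + x1 * x3 * x4 + x2 * x3 * x4"
    "of_int d = x1 * x2 * x3 * x4"
proof -
  define q where "q = [:x1 * x2 * x3 * x4,
    - (x1 * x2 * x3 + x1 * x2 * x4 + x1 * x3 * x4 + x2 * x3 * x4),
    x1 * x2 + x1 * x3 + x1 * x4 + x2 * x3 + x2 * x4 + x3 * x4, - (x1 + x2 + x3 + x4), 1:]"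
  have "poly (map_poly of_int p) = poly q"
    using assms by (simp add: q_def fun_eq_iff algebra_simps)
  then have "map_poly of_int p = q" by (simp add: poly_eq_poly_eq_iff)
  then have "complex_of_int (coeff p k) = coeff q k" for k
    by (metis coeff_map_poly of_int_0)
  from this[of 3] this[of 2] this[of 1] this[of 0] show ?thesis
    by (intro that[of "- coeff p 3" "coeff p 2" "- coeff p 1" "coeff p 0"])
      (simp_all add: q_def coeff_pCons eval_nat_numeral)
qed

section \<open>Tori from quartics\<close>

lemma basis4I:
  fixes v :: "4 \<Rightarrow> 'a::real_vector"
  assumes zero: "\<And>x i. (\<Sum>i\<in>UNIV. x i *\<^sub>R v i) = 0 \<Longrightarrow> x i = 0"
  shows "inj v" "independent (range v)"
proof -
  show inj: "inj v"
  proof (rule injI, rule ccontr)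
    fix i j assume eq: "v i = v j" "i \<noteq> j"
    define x :: "4 \<Rightarrow> real" where "x k = (if k = i then 1 else 0) - (if k = j then 1 else 0)" for k
    have "(\<Sum>k\<in>UNIV. x k *\<^sub>R v k) = (\<Sum>k\<in>UNIV. (if k = i then v k else 0) - (if k = j then v k else 0))"
      by (intro sum.cong) (auto simp: x_def)
    also have "\<dots> = v i - v j" by (simp add: sum_subtractf)
    finally have "x i = 0" using eq zero by simp
    then show False using eq by (simp add: x_def)
  qed
  show "independent (range v)"
  proof (rule independent_if_scalars_zero)
    fix f x assume 0: "(\<Sum>x\<in>range v. f x *\<^sub>R x) = 0" and "x \<in> range v"
    then obtain i where i: "x = v i" by blast
    have "(\<Sum>i\<in>UNIV. f (v i) *\<^sub>R v i) = 0"
      using 0 inj by (subst (asm) sum.reindex) auto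
    then have "f (v i) = 0" by (rule zero[of "\<lambda>i. f (v i)"])
    then show "f x = 0" by (simp add: i)
  qed simp
qed

lemma complex_linear2_holo2:
  assumes A: "complex_linear2 A"
  shows "holo2 A"
proof -
  have "linear A"
    using A by (intro linearI) (simp_all add: complex_linear2_scaleR, simp add: complex_linear2_def)
  then have "(A has_derivative A) (at z)" for z
    by (simp add: bounded_linear_imp_has_derivative linear_conv_bounded_linear)
  then show ?thesis using A unfolding holo2_def complex_linear2_def by blast
qed

text \<open>A real cubic with roots \<open>w\<close> and \<open>z\<close> also has their conjugates
  as roots. Nonreal numbers of different modulus make these four distinct points, too many for a
  nonzero cubic.\<close>

lemma cubic_four_roots:
  fixes w z :: complex and x0 x1 x2 x3 :: real
  assumes "Im w \<noteq> 0" "Im z \<noteq> 0" "cmod w \<noteq> cmod z"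
    and w: "of_real x0 + of_real x1 * w + of_real x2 * w ^ 2 + of_real x3 * w ^ 3 = 0"
    and z: "of_real x0 + of_real x1 * z + of_real x2 * z ^ 2 + of_real x3 * z ^ 3 = 0"
  shows "x0 = 0 \<and> x1 = 0 \<and> x2 = 0 \<and> x3 = 0"
proof -
  define p where "p = [:complex_of_real x0, of_real x1, of_real x2, of_real x3:]"
  have p: "poly p y = of_real x0 + of_real x1 * y + of_real x2 * y ^ 2 + of_real x3 * y ^ 3" for y
    by (simp add: p_def algebra_simps power2_eq_square power3_eq_cube)
  have cnj: "poly p (cnj y) = cnj (poly p y)" for y
    by (simp add: p)
  have roots: "poly p w = 0" "poly p z = 0" "poly p (cnj w) = 0" "poly p (cnj z) = 0"
    unfolding cnj using w z by (simp_all add: p)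
  have "p = 0"
  proof (rule ccontr)
    assume "p \<noteq> 0"
    have "w \<noteq> cnj w" "z \<noteq> cnj z" using assms(1,2) by (auto simp: complex_eq_iff)
    moreover have "w \<noteq> z" "w \<noteq> cnj z" "cnj w \<noteq> z" "cnj w \<noteq> cnj z"
      using assms(3) by auto
    ultimately have "card {w, cnj w, z, cnj z} = 4" by auto
    moreover have "card {w, cnj w, z, cnj z} \<le> card {y. poly p y = 0}"
      using roots poly_roots_finite[OF \<open>p \<noteq> 0\<close>] by (intro card_mono) auto
    moreover have "card {y. poly p y = 0} \<le> degree p" using card_poly_roots_bound[OF \<open>p \<noteq> 0\<close>] .
    moreover have "degree p \<le> 3" by (simp add: p_def)
    ultimately show False by simp
  qed
  then show ?thesis by (simp add: p_def)
qed

text \<open>The lattice is the image of \<open>Z[x] / (quartic)\<close> under evaluation at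
  \<open>w\<close> and \<open>z\<close>, and \<open>A\<close> is multiplication by \<open>x\<close>.
  The constant term 1 makes \<open>x\<close> a unit, so the inverse preserves the lattice
  too.\<close>

lemma torus_entropy_value_of_quartic:
  fixes w z :: complex and a b c :: int
  assumes Im: "Im w \<noteq> 0" "Im z \<noteq> 0" and mod: "cmod w > 1" "cmod z < 1"
    and w: "w ^ 4 - of_int a * w ^ 3 + of_int b * w ^ 2 - of_int c * w + 1 = 0"
    and z: "z ^ 4 - of_int a * z ^ 3 + of_int b * z ^ 2 - of_int c * z + 1 = 0"
  shows "torus_entropy_value (ln (cmod w ^ 2))"
proof -
  define \<alpha> :: "2 \<Rightarrow> complex" where "\<alpha> j = (if j = 1 then w else z)" for j
  have \<alpha>_12: "\<alpha> 1 = w" "\<alpha> 2 = z" by (simp_all add: \<alpha>_def)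
  have \<alpha>_eq: "\<alpha> j ^ 4 = of_int a * \<alpha> j ^ 3 - of_int b * \<alpha> j ^ 2 + of_int c * \<alpha> j - 1" for j
    using w z unfolding \<alpha>_def by (auto simp: algebra_simps eq_neg_iff_add_eq_0 add_eq_0_iff)
  have \<alpha>_ne: "\<alpha> j \<noteq> 0" for j
    using Im by (auto simp: \<alpha>_def)
  define ex :: "4 \<Rightarrow> nat" where "ex i = (if i = 1 then 0 else if i = 2 then 1 else if i = 3 then 2 else 3)" for i
  have ex: "ex 1 = 0" "ex 2 = 1" "ex 3 = 2" "ex 4 = 3" by (simp_all add: ex_def)
  define v :: "4 \<Rightarrow> complex ^ 2" where "v i = (\<chi> j. \<alpha> j ^ ex i)" for i
  have v_sum: "(\<Sum>i\<in>UNIV. x i *\<^sub>R v i) $ j =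
      of_real (x 1) + of_real (x 2) * \<alpha> j + of_real (x 3) * \<alpha> j ^ 2 + of_real (x 4) * \<alpha> j ^ 3" for x j
    by (simp add: sum_4 v_def ex scaleR_conv_of_real[where 'a = complex])
  have "x i = 0" if "(\<Sum>i\<in>UNIV. x i *\<^sub>R v i) = 0" for x i
  proof -
    have eq: "of_real (x 1) + of_real (x 2) * \<alpha> j + of_real (x 3) * \<alpha> j ^ 2 + of_real (x 4) * \<alpha> j ^ 3 = 0" for j
      using v_sum[of x j] unfolding that by simp
    have "x 1 = 0 \<and> x 2 = 0 \<and> x 3 = 0 \<and> x 4 = 0"
      using eq[of 1] eq[of 2] mod unfolding \<alpha>_12 by (intro cubic_four_roots[OF Im]) auto
    then show ?thesis using exhaust_4[of i] by auto
  qed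
  then have v: "inj v" "independent (range v)"
    using basis4I[of v] by blast+
  define L where "L = {(\<Sum>i\<in>UNIV. real_of_int (n i) *\<^sub>R v i) | n :: 4 \<Rightarrow> int. True}"
  have L: "lattice4 L" unfolding lattice4_def L_def using v by blast
  have L_iff: "y \<in> L \<longleftrightarrow> (\<exists>n0 n1 n2 n3 :: int. \<forall>j. y $ j = of_int n0 + of_int n1 * \<alpha> j + of_int n2 * \<alpha> j ^ 2 + of_int n3 * \<alpha> j ^ 3)"
    (is "_ \<longleftrightarrow> ?R") for y
  proof
    assume "y \<in> L"
    then obtain n :: "4 \<Rightarrow> int" where y: "y = (\<Sum>i\<in>UNIV. real_of_int (n i) *\<^sub>R v i)" unfolding L_def by blast
    have "y $ j = of_int (n 1) + of_int (n 2) * \<alpha> j + of_int (n 3) * \<alpha> j ^ 2 + of_int (n 4) * \<alpha> j ^ 3" for j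
      unfolding y v_sum by simp
    then show ?R by blast
  next
    assume ?R
    then obtain n0 n1 n2 n3 :: int where n: "\<And>j. y $ j = of_int n0 + of_int n1 * \<alpha> j + of_int n2 * \<alpha> j ^ 2 + of_int n3 * \<alpha> j ^ 3"
      by blast
    define n :: "4 \<Rightarrow> int" where "n i = (if i = 1 then n0 else if i = 2 then n1 else if i = 3 then n2 else n3)" for i
    have "n 1 = n0" "n 2 = n1" "n 3 = n2" "n 4 = n3" by (simp_all add: n_def)
    then have "y = (\<Sum>i\<in>UNIV. real_of_int (n i) *\<^sub>R v i)"
      unfolding vec_eq_iff v_sum n by simp
    then show "y \<in> L" unfolding L_def by blast
  qed
  define A B :: "complex ^ 2 \<Rightarrow> complex ^ 2" where "A y = (\<chi> j. \<alpha> j * y $ j)" and "B y = (\<chi> j. y $ j / \<alpha> j)" for y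
  have lin: "complex_linear2 A" "complex_linear2 B"
    by (simp_all add: complex_linear2_def A_def B_def vec_eq_iff algebra_simps add_divide_distrib)
  have AB: "A (B y) = y" "B (A y) = y" for y
    using \<alpha>_ne by (simp_all add: A_def B_def vec_eq_iff)
  have A_L: "A y \<in> L" if y_L: "y \<in> L" for y
  proof -
    obtain n0 n1 n2 n3 :: int where n: "\<And>j. y $ j = of_int n0 + of_int n1 * \<alpha> j + of_int n2 * \<alpha> j ^ 2 + of_int n3 * \<alpha> j ^ 3"
      using y_L unfolding L_iff by blast
    have "A y $ j = of_int (- n3) + of_int (n0 + c * n3) * \<alpha> j + of_int (n1 - b * n3) * \<alpha> j ^ 2 + of_int (n2 + a * n3) * \<alpha> j ^ 3" for j
    proof -
      have "A y $ j = of_int n0 * \<alpha> j + of_int n1 * \<alpha> j ^ 2 + of_int n2 * \<alpha> j ^ 3 + of_int n3 * \<alpha> j ^ 4"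
        by (simp add: A_def n algebra_simps eval_nat_numeral)
      then show ?thesis unfolding \<alpha>_eq by (simp add: algebra_simps)
    qed
    then show ?thesis unfolding L_iff by blast
  qed
  have B_L: "B y \<in> L" if y_L: "y \<in> L" for y
  proof -
    obtain n0 n1 n2 n3 :: int where n: "\<And>j. y $ j = of_int n0 + of_int n1 * \<alpha> j + of_int n2 * \<alpha> j ^ 2 + of_int n3 * \<alpha> j ^ 3"
      using y_L unfolding L_iff by blast
    have "B y $ j = of_int (n1 + c * n0) + of_int (n2 - b * n0) * \<alpha> j + of_int (n3 + a * n0) * \<alpha> j ^ 2 + of_int (- n0) * \<alpha> j ^ 3" for j
    proof -
      \<comment> \<open>The quartic equation exhibits the inverse of the root as an integer
        polynomial in the root.\<close>
      have "1 = \<alpha> j * (of_int c - of_int b * \<alpha> j + of_int a * \<alpha> j ^ 2 - \<alpha> j ^ 3)"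
        using \<alpha>_eq[of j] by (simp add: algebra_simps eval_nat_numeral)
      then have "y $ j = \<alpha> j * (of_int (n1 + c * n0) + of_int (n2 - b * n0) * \<alpha> j + of_int (n3 + a * n0) * \<alpha> j ^ 2 + of_int (- n0) * \<alpha> j ^ 3)"
        unfolding n by (simp only: of_int_add of_int_mult of_int_diff of_int_minus) algebra
      then show ?thesis using \<alpha>_ne[of j] by (simp add: B_def field_simps)
    qed
    then show ?thesis unfolding L_iff by blast
  qed
  have desc: "descends L C" if "complex_linear2 C" "\<And>l. l \<in> L \<Longrightarrow> C l \<in> L" for C
    using that unfolding descends_def complex_linear2_def by simp
  have "torus_aut L A"
    unfolding torus_aut_def
  proof (intro conjI exI[of _ B])
    show "descends L A" "descends L B" using desc lin A_L B_L by blast+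
    show "holo2 A" "holo2 B" using lin by (simp_all add: complex_linear2_holo2)
    show "\<forall>z. B (A z) - z \<in> L" "\<forall>z. A (B z) - z \<in> L"
      using lattice4_zero[OF L] by (simp_all add: AB)
  qed
  moreover
  interpret torus_map_coords L A A "\<lambda>y :: complex ^ 2. y $ 1" "\<lambda>y :: complex ^ 2. y $ 2" "axis 1 1" "axis 2 1" w z 0
  proof
    show "A y = A 0 + A y" for y using complex_linear2_zero[OF lin(1)] by simp
    show "y = y $ 1 *s axis 1 1 + y $ 2 *s axis 2 1" for y :: "complex ^ 2"
      by (simp add: vec_eq_iff forall_2 axis_def)
  qed (use L lin A_L mod in \<open>auto simp: A_def \<alpha>_12 axis_def\<close>)
  have "top_entropy L A = ereal (ln (cmod w ^ 2))"
    by (rule top_entropy_eq) (rule mod(1))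
  ultimately show ?thesis unfolding torus_entropy_value_def using L by blast
qed

lemma quadratic_complex_root:
  fixes p r :: real
  assumes "p\<^sup>2 < 4 * r"
  obtains w :: complex where "w\<^sup>2 - of_real p * w + of_real r = 0" "Im w \<noteq> 0" "cmod w ^ 2 = r"
proof
  define d where "d = r - (p / 2)\<^sup>2"
  have "d > 0" using assms by (simp add: d_def power_divide)
  then have sq: "sqrt d * sqrt d = r - (p / 2) * (p / 2)" by (simp add: d_def power2_eq_square)
  let ?w = "Complex (p / 2) (sqrt d)"
  show "?w\<^sup>2 - of_real p * ?w + of_real r = 0"
    using sq by (simp add: complex_eq_iff power2_eq_square)
  show "Im ?w \<noteq> 0" using \<open>d > 0\<close> by simp
  show "cmod ?w ^ 2 = r" unfolding cmod_power2 using sq by (simp add: power2_eq_square)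
qed

text \<open>The quartic \<open>x^4 - a x^3 + b x^2 - c x + 1\<close> is split over the reals into factors with constant
  terms \<open>lam\<close> and \<open>1 / lam\<close>; the two excess quantities \<open>U\<close>, \<open>V\<close>, up to a positive factor the
  negated discriminants, have sum \<open>4 - t2 t3\<close> and product \<open>(t2 - t3)^2\<close>.\<close>

lemma torus_entropy_value_of_traces:
  fixes lam t2 t3 :: real and a b c :: int
  assumes lam: "lam > 1" and t: "t = lam + 1 / lam"
    and t23: "\<bar>t2\<bar> \<le> 2" "\<bar>t3\<bar> \<le> 2" "t2 \<noteq> t3"
    and b: "of_int b = t + t2 + t3"
    and ac: "of_int a * of_int c - 4 = t * t2 + t * t3 + t2 * t3"
    and aacc: "of_int a ^ 2 + of_int c ^ 2 - 4 * of_int b = t * t2 * t3"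
  shows "torus_entropy_value (ln lam)"
proof -
  define m where "m = lam\<^sup>2 - 1"
  have "lam * lam > 1 * 1" using lam by (intro mult_strict_mono) auto
  then have "m > 0" by (simp add: m_def power2_eq_square)
  \<comment> \<open>These solve \<open>p + q = a\<close> and \<open>p / lam + q * lam = c\<close>,
    as required for a factorization of the quartic into \<open>x^2 - p x + lam\<close> and
    \<open>x^2 - q x + 1 / lam\<close>.\<close>
  define p q where "p = lam * (of_int a * lam - of_int c) / m" and "q = (of_int c * lam - of_int a) / m"
  have pm: "p * m = lam * (of_int a * lam - of_int c)" and qm: "q * m = of_int c * lam - of_int a"
    using \<open>m > 0\<close> by (simp_all add: p_def q_def)
  have tl: "t * lam = lam\<^sup>2 + 1" using lam by (simp add: t field_simps power2_eq_square)
  have pq_a: "p + q = of_int a"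
  proof -
    have "(p + q) * m = of_int a * m"
      unfolding distrib_right pm qm by (simp add: m_def algebra_simps power2_eq_square)
    then show ?thesis using \<open>m > 0\<close> by simp
  qed
  have pq_c: "p + q * lam\<^sup>2 = of_int c * lam"
  proof -
    have "(p + q * lam\<^sup>2) * m = p * m + (q * m) * lam\<^sup>2" by (simp add: algebra_simps)
    also have "\<dots> = of_int c * lam * m"
      unfolding pm qm by (simp add: m_def algebra_simps power2_eq_square)
    finally show ?thesis using \<open>m > 0\<close> by simp
  qed
  \<comment> \<open>This matches the coefficient of \<open>x^2\<close>, which in the product is
    \<open>lam + 1 / lam + p q\<close> and in the quartic \<open>b = t + t2 + t3\<close>.\<close>
  have pq: "p * q = t2 + t3"
  proof -
    have "(p * q) * m\<^sup>2 = (p * m) * (q * m)" by (simp add: power2_eq_square)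
    also have "\<dots> = lam * (of_int a * of_int c * (lam\<^sup>2 + 1) - (of_int a ^ 2 + of_int c ^ 2) * lam)"
      unfolding pm qm by (simp add: algebra_simps power2_eq_square)
    also have "\<dots> = lam\<^sup>2 * ((of_int a * of_int c) * t - (of_int a ^ 2 + of_int c ^ 2))"
      unfolding tl[symmetric] by (simp add: algebra_simps power2_eq_square)
    also have "of_int a * of_int c = 4 + t * t2 + t * t3 + t2 * t3" using ac by simp
    also have "of_int a ^ 2 + of_int c ^ 2 = t * t2 * t3 + 4 * (t + t2 + t3)" using aacc b by simp
    also have "lam\<^sup>2 * ((4 + t * t2 + t * t3 + t2 * t3) * t - (t * t2 * t3 + 4 * (t + t2 + t3)))
        = (t2 + t3) * ((t * lam)\<^sup>2 - 4 * lam\<^sup>2)" by algebra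
    also have "(t * lam)\<^sup>2 - 4 * lam\<^sup>2 = m\<^sup>2" unfolding tl m_def by algebra
    finally show ?thesis using \<open>m > 0\<close> by simp
  qed
  define U V where "U = 4 - p\<^sup>2 / lam" and "V = 4 - q\<^sup>2 * lam"
  have sumUV: "U + V = 4 - t2 * t3"
  proof -
    have "(p + q) * (p + q * lam\<^sup>2) = p\<^sup>2 + p * q * (t * lam) + q\<^sup>2 * lam\<^sup>2"
      unfolding tl by algebra
    then have "lam * (of_int a * of_int c) = p\<^sup>2 + p * q * (t * lam) + q\<^sup>2 * lam\<^sup>2"
      unfolding pq_a pq_c by (simp add: mult_ac)
    then have "of_int a * of_int c = p\<^sup>2 / lam + p * q * t + q\<^sup>2 * lam"
      using lam by (simp add: field_simps power2_eq_square)
    then show ?thesis using ac unfolding U_def V_def pq by (simp add: algebra_simps)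
  qed
  have prodUV: "U * V = (t2 - t3)\<^sup>2"
  proof -
    have "U * V = 4 * (U + V) - 16 + (p * q)\<^sup>2"
      using lam by (simp add: U_def V_def field_simps power2_eq_square)
    then show ?thesis unfolding sumUV pq by (simp add: algebra_simps power2_eq_square)
  qed
  \<comment> \<open>Distinct traces make the product positive, so the signs agree, and the bound on
    the traces makes the sum nonnegative. This excludes real roots.\<close>
  have "U > 0" "V > 0"
  proof -
    have "0 < U * V" unfolding prodUV using t23(3) by simp
    moreover have "t2 * t3 \<le> 4"
    proof -
      have "\<bar>t2\<bar> * \<bar>t3\<bar> \<le> 2 * 2" using t23 by (intro mult_mono) auto
      then show ?thesis using abs_ge_self[of "t2 * t3"] by (simp add: abs_mult)
    qed
    then have "0 \<le> U + V" unfolding sumUV by simp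
    ultimately show "U > 0" "V > 0" by (auto simp: zero_less_mult_iff)
  qed
  have disc1: "p\<^sup>2 < 4 * lam" using \<open>U > 0\<close> lam by (simp add: U_def field_simps)
  have disc2: "q\<^sup>2 < 4 * (1 / lam)" using \<open>V > 0\<close> lam by (simp add: V_def field_simps)
  obtain w :: complex where w: "w\<^sup>2 - of_real p * w + of_real lam = 0" "Im w \<noteq> 0" "cmod w ^ 2 = lam"
    using quadratic_complex_root[OF disc1] by blast
  obtain z :: complex where z: "z\<^sup>2 - of_real q * z + of_real (1 / lam) = 0" "Im z \<noteq> 0" "cmod z ^ 2 = 1 / lam"
    using quadratic_complex_root[OF disc2] by blast
  have quartic: "x ^ 4 - of_int a * x ^ 3 + of_int b * x ^ 2 - of_int c * x + 1 =
      (x\<^sup>2 - of_real p * x + of_real lam) * (x\<^sup>2 - of_real q * x + of_real (1 / lam))" for x :: complex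
  proof -
    have A: "of_int a = of_real p + (of_real q :: complex)" using arg_cong[OF pq_a, of complex_of_real] by simp
    have B: "of_int b = of_real lam + of_real (1 / lam) + of_real p * (of_real q :: complex)"
    proof -
      have "of_int b = lam + 1 / lam + p * q" unfolding b pq t by simp
      then show ?thesis by (metis of_real_add of_real_mult of_real_of_int_eq)
    qed
    have C: "of_int c = of_real p * of_real (1 / lam) + of_real q * (of_real lam :: complex)"
    proof -
      have "of_int c = p * (1 / lam) + q * lam"
        using pq_c lam by (simp add: field_simps power2_eq_square)
      then show ?thesis by (metis of_real_add of_real_mult of_real_of_int_eq)
    qed
    have 1: "of_real lam * of_real (1 / lam) = (1 :: complex)" using lam by simp
    show ?thesis unfolding A B C using 1 by algebra
  qed
  have "cmod w > 1" using w(3) lam power_le_one[of "cmod w" 2] by (metis linorder_not_le norm_ge_zero)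
  moreover have "cmod z < 1"
  proof (rule ccontr)
    assume "\<not> cmod z < 1"
    then have "1 \<le> cmod z ^ 2" by (intro one_le_power) simp
    then show False using z(3) lam by (simp add: field_simps)
  qed
  ultimately have "torus_entropy_value (ln (cmod w ^ 2))"
    using w z quartic[of w] quartic[of z]
    by (intro torus_entropy_value_of_quartic[of w z a b c]) auto
  then show ?thesis unfolding w(3) .
qed

section \<open>Entropies of torus automorphisms\<close>

lemma complex_quadratic_roots:
  fixes s r :: complex
  obtains x y where "x + y = s" "x * y = r"
proof
  let ?d = "csqrt (s\<^sup>2 - 4 * r)"
  show "(s + ?d) / 2 + (s - ?d) / 2 = s" by (simp add: field_simps)
  have "(s + ?d) * (s - ?d) = s\<^sup>2 - ?d\<^sup>2" by algebra
  then show "(s + ?d) / 2 * ((s - ?d) / 2) = r" by simp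
qed

lemma left_eigenvector2:
  fixes p q r s al :: complex
  assumes "al\<^sup>2 - (p + s) * al + (p * s - q * r) = 0"
  obtains x y where "x * p + y * r = al * x" "x * q + y * s = al * y" "x \<noteq> 0 \<or> y \<noteq> 0"
proof -
  have char: "(al - p) * (al - s) = q * r"
    using assms by algebra
  show ?thesis
  proof (cases "r = 0")
    case False
    have "r * p + (al - p) * r = al * r"
      by algebra
    moreover have "r * q + (al - p) * s = al * (al - p)"
      using char by algebra
    ultimately show ?thesis using that False by blast
  next
    case r: True
    show ?thesis
    proof (cases "q = 0")
      case False
      have "(al - s) * p + q * r = al * (al - s)"
        using char r by algebra
      moreover have "(al - s) * q + q * s = al * q"
        by algebra
      ultimately show ?thesis using that False by blast
    next
      case True
      then have "al = p \<or> al = s" using char r by auto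
      then show ?thesis using that[of 1 0] that[of 0 1] r True by auto
    qed
  qed
qed

text \<open>Row vectors are wanted because they are the coefficients of coordinate functionals. For
  a double eigenvalue any row vector independent of an eigenvector completes the basis, and
  \<open>be\<close> measures its failure to be an eigenvector.\<close>

lemma left_triangularize2:
  fixes p q r s :: complex
  obtains x1 y1 x2 y2 al1 al2 be where "x1 * y2 - x2 * y1 \<noteq> 0"
    "x1 * p + y1 * r = al1 * x1 + be * x2" "x1 * q + y1 * s = al1 * y1 + be * y2"
    "x2 * p + y2 * r = al2 * x2" "x2 * q + y2 * s = al2 * y2"
    "cmod al2 \<le> cmod al1" "be = 0 \<or> al1 = al2"
proof -
  obtain a1 a2 where a: "a1 + a2 = p + s" "a1 * a2 = p * s - q * r"
    by (rule complex_quadratic_roots)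
  obtain al1 al2 where al: "al1 + al2 = p + s" "al1 * al2 = p * s - q * r" "cmod al2 \<le> cmod al1"
  proof (cases "cmod a2 \<le> cmod a1")
    case True
    then show ?thesis using that[of a1 a2] a by blast
  next
    case False
    then show ?thesis using that[of a2 a1] a by (simp add: add.commute mult.commute)
  qed
  have "al1\<^sup>2 - (p + s) * al1 + (p * s - q * r) = 0" "al2\<^sup>2 - (p + s) * al2 + (p * s - q * r) = 0"
    unfolding al(1,2)[symmetric] by algebra+
  then obtain x1 y1 x2 y2 where e1: "x1 * p + y1 * r = al1 * x1" "x1 * q + y1 * s = al1 * y1" "x1 \<noteq> 0 \<or> y1 \<noteq> 0"
    and e2: "x2 * p + y2 * r = al2 * x2" "x2 * q + y2 * s = al2 * y2" "x2 \<noteq> 0 \<or> y2 \<noteq> 0"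
    by (metis left_eigenvector2)
  show ?thesis
  proof (cases "al1 = al2")
    case False
    have "x1 * y2 - x2 * y1 \<noteq> 0"
    proof
      assume D: "x1 * y2 - x2 * y1 = 0"
      have "(al1 - al2) * (x1 * y2) = 0"
        using D e1(1,2) e2(1,2) by algebra
      moreover have "(al1 - al2) * (x1 * x2) = 0"
        using D e1(1,2) e2(1,2) by algebra
      moreover have "(al1 - al2) * (y1 * y2) = 0"
        using D e1(1,2) e2(1,2) by algebra
      ultimately have z: "x1 * y2 = 0" "x1 * x2 = 0" "y1 * y2 = 0" using False by simp_all
      moreover have "x2 * y1 = 0" using D unfolding z(1) by simp
      ultimately show False using e1(3) e2(3) by auto
    qed
    then show ?thesis using that[of x1 y2 x2 y1 al1 0 al2] e1 e2 al(3) by simp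
  next
    case True
    show ?thesis
    proof (cases "x2 = 0")
      case False
      have "0 * p + 1 * r = al1 * 0 + (r / x2) * x2" using False by simp
      moreover have "0 * q + 1 * s = al1 * 1 + (r / x2) * y2"
      proof -
        have "x2 * s = x2 * al1 + r * y2"
          using e2(1) al(1) True by algebra
        then show ?thesis using False by (simp add: field_simps)
      qed
      ultimately show ?thesis
        using that[of 0 y2 x2 1 al1 "r / x2" al2] e2 al(3) True False by simp
    next
      case x2: True
      then have y2: "y2 \<noteq> 0" using e2(3) by simp
      have "r = 0" using e2(1) x2 y2 by simp
      have "s = al2" using e2(2) x2 y2 by simp
      then have "p = al1" using al(1) True by simp
      then show ?thesis
        using that[of 1 y2 x2 0 al1 "q / y2" al2] e2 al(3) True x2 y2 \<open>r = 0\<close> by simp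
    qed
  qed
qed

lemma complex_linear2_triangular_coords:
  assumes A: "complex_linear2 A"
  obtains l1 l2 :: "complex ^ 2 \<Rightarrow> complex" and u1 u2 al1 al2 be where
    "\<And>x y. l1 (x + y) = l1 x + l1 y" "\<And>c x. l1 (c *s x) = c * l1 x"
    "\<And>x y. l2 (x + y) = l2 x + l2 y" "\<And>c x. l2 (c *s x) = c * l2 x"
    "\<And>z. z = l1 z *s u1 + l2 z *s u2"
    "l1 u1 = 1" "l2 u1 = 0" "l1 u2 = 0" "l2 u2 = 1"
    "\<And>z. l1 (A z) = al1 * l1 z + be * l2 z" "\<And>z. l2 (A z) = al2 * l2 z"
    "cmod al2 \<le> cmod al1" "be = 0 \<or> al1 = al2"
proof -
  let ?e1 = "axis 1 1 :: complex ^ 2" and ?e2 = "axis 2 1 :: complex ^ 2"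
  define p q r s where "p = A ?e1 $ 1" and "q = A ?e2 $ 1" and "r = A ?e1 $ 2" and "s = A ?e2 $ 2"
  have A_eq: "A z = z $ 1 *s A ?e1 + z $ 2 *s A ?e2" for z
  proof -
    have "z = z $ 1 *s ?e1 + z $ 2 *s ?e2" by (simp add: vec_eq_iff forall_2 axis_def)
    then have "A z = A (z $ 1 *s ?e1 + z $ 2 *s ?e2)" by (rule arg_cong)
    also have "\<dots> = z $ 1 *s A ?e1 + z $ 2 *s A ?e2" using A unfolding complex_linear2_def by simp
    finally show ?thesis .
  qed
  have A1: "A z $ 1 = p * z $ 1 + q * z $ 2" and A2: "A z $ 2 = r * z $ 1 + s * z $ 2" for z
    unfolding A_eq[of z] by (simp_all add: p_def q_def r_def s_def)
  obtain x1 y1 x2 y2 al1 al2 be where D: "x1 * y2 - x2 * y1 \<noteq> 0"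
    and e: "x1 * p + y1 * r = al1 * x1 + be * x2" "x1 * q + y1 * s = al1 * y1 + be * y2"
      "x2 * p + y2 * r = al2 * x2" "x2 * q + y2 * s = al2 * y2"
    and al: "cmod al2 \<le> cmod al1" "be = 0 \<or> al1 = al2"
    by (rule left_triangularize2)
  define D where "D = x1 * y2 - x2 * y1"
  have D0: "D \<noteq> 0" using \<open>x1 * y2 - x2 * y1 \<noteq> 0\<close> by (simp add: D_def)
  define l1 l2 :: "complex ^ 2 \<Rightarrow> complex" where "l1 z = x1 * z $ 1 + y1 * z $ 2" and "l2 z = x2 * z $ 1 + y2 * z $ 2" for z
  define u1 u2 :: "complex ^ 2" where "u1 = (\<chi> i. if i = 1 then y2 / D else - x2 / D)"
    and "u2 = (\<chi> i. if i = 1 then - y1 / D else x1 / D)"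
  show ?thesis
  proof (rule that[of l1 l2 u1 u2 al1 be al2])
    show "l1 (x + y) = l1 x + l1 y" "l2 (x + y) = l2 x + l2 y" for x y
      by (simp_all add: l1_def l2_def algebra_simps)
    show "l1 (c *s x) = c * l1 x" "l2 (c *s x) = c * l2 x" for c x
      by (simp_all add: l1_def l2_def algebra_simps)
    show "z = l1 z *s u1 + l2 z *s u2" for z
    proof -
      have "z $ 1 * D = l1 z * y2 - l2 z * y1" "z $ 2 * D = l2 z * x1 - l1 z * x2"
        unfolding l1_def l2_def D_def by algebra+
      then show ?thesis using D0 by (simp add: vec_eq_iff forall_2 u1_def u2_def field_simps)
    qed
    show "l1 u1 = 1" "l2 u1 = 0" "l1 u2 = 0" "l2 u2 = 1"
      using D0 by (simp_all add: l1_def l2_def u1_def u2_def field_simps) (simp_all add: D_def algebra_simps)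
    show "l1 (A z) = al1 * l1 z + be * l2 z" for z
      using e unfolding l1_def l2_def A1 A2 by algebra
    show "l2 (A z) = al2 * l2 z" for z
      using e unfolding l2_def A1 A2 by algebra
  qed (use al in auto)
qed

text \<open>The characteristic polynomials of \<open>A\<close> and of its inverse on the lattice
  have integer constant terms with product 1. The first of these is
  \<open>(cmod al1 * cmod al2)^2\<close>, which is nonnegative and therefore 1.\<close>

lemma torus_aut_entropy:
  assumes L: "lattice4 L" and f: "torus_aut L f" and pos: "top_entropy L f > 0"
  obtains lam a b c where "lam > 1" "top_entropy L f = ereal (ln lam)"
    "ipoly (ext_sq_poly a b c) lam = 0"
    "\<And>z :: complex. ipoly (ext_sq_poly a b c) z = 0 \<Longrightarrow>
      cmod z = 1 \<or> z = of_real lam \<or> z = of_real (1 / lam)"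
proof -
  obtain A B where A: "complex_linear2 A" and B: "complex_linear2 B" and f_eq: "\<And>z. f z = f 0 + A z"
    and A_L: "\<And>l. l \<in> L \<Longrightarrow> A l \<in> L" and B_L: "\<And>l. l \<in> L \<Longrightarrow> B l \<in> L"
    and BA: "\<And>z. B (A z) = z" and AB: "\<And>z. A (B z) = z"
    using torus_aut_affine[OF L f] by blast
  obtain l1 l2 :: "complex ^ 2 \<Rightarrow> complex" and u1 u2 al1 al2 be where
    l1: "\<And>x y. l1 (x + y) = l1 x + l1 y" "\<And>c x. l1 (c *s x) = c * l1 x"
    and l2: "\<And>x y. l2 (x + y) = l2 x + l2 y" "\<And>c x. l2 (c *s x) = c * l2 x"
    and coords: "\<And>z. z = l1 z *s u1 + l2 z *s u2"
    and lu: "l1 u1 = 1" "l2 u1 = 0" "l1 u2 = 0" "l2 u2 = 1"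
    and lA: "\<And>z. l1 (A z) = al1 * l1 z + be * l2 z" "\<And>z. l2 (A z) = al2 * l2 z"
    and al_le: "cmod al2 \<le> cmod al1" and be: "be = 0 \<or> al1 = al2"
    by (rule complex_linear2_triangular_coords[OF A]) (rule that)
  have al2_0: "al2 \<noteq> 0" using lA(2)[of "B u2"] lu by (auto simp: AB)
  have l2_B_u1: "l2 (B u1) = 0" using lA(2)[of "B u1"] lu al2_0 by (auto simp: AB)
  have al1_0: "al1 \<noteq> 0" using lA(1)[of "B u1"] lu l2_B_u1 by (auto simp: AB)
  \<comment> \<open>The same functionals triangularize the inverse, so its characteristic polynomial
    on the lattice is obtained in the same way.\<close>
  have lB: "l1 (B z) = inverse al1 * l1 z + (- be / (al1 * al2)) * l2 z" "l2 (B z) = inverse al2 * l2 z" for z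
  proof -
    show 2: "l2 (B z) = inverse al2 * l2 z"
      using lA(2)[of "B z"] al2_0 by (simp add: AB)
    have "l1 z = al1 * l1 (B z) + be * l2 (B z)"
      using lA(1)[of "B z"] by (simp add: AB)
    then show "l1 (B z) = inverse al1 * l1 z + (- be / (al1 * al2)) * l2 z"
      unfolding 2 using al1_0 al2_0 by (simp add: field_simps)
  qed
  obtain p where p: "\<And>t :: complex. ipoly p t = (t - al1) * (t - cnj al1) * (t - al2) * (t - cnj al2)"
    using lattice_char_poly[OF L A A_L l1 l2 lu lA] by blast
  obtain a b c d where abc: "of_int a = al1 + cnj al1 + al2 + cnj al2"
    "of_int b = al1 * cnj al1 + al1 * al2 + al1 * cnj al2 + cnj al1 * al2 + cnj al1 * cnj al2 + al2 * cnj al2"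
    "of_int c = al1 * cnj al1 * al2 + al1 * cnj al1 * cnj al2 + al1 * al2 * cnj al2 + cnj al1 * al2 * cnj al2"
    and d: "of_int d = al1 * cnj al1 * al2 * cnj al2"
    by (rule lattice_char_coeffs[OF p])
  obtain p' where p': "\<And>t :: complex. ipoly p' t =
      (t - inverse al1) * (t - cnj (inverse al1)) * (t - inverse al2) * (t - cnj (inverse al2))"
    using lattice_char_poly[OF L B B_L l1 l2 lu lB] by blast
  obtain d' where d': "of_int d' = inverse al1 * cnj (inverse al1) * inverse al2 * cnj (inverse al2)"
    by (rule lattice_char_coeffs[OF p'])
  have "of_int (d * d') = (1 :: complex)"
    unfolding of_int_mult d d' using al1_0 al2_0 by (simp add: field_simps)
  then have "d * d' = 1" by (simp only: of_int_eq_1_iff)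
  then have "d = 1 \<or> d = -1" by (auto simp: zmult_eq_1_iff)
  moreover have d_sq: "complex_of_int d = of_real ((cmod al1 * cmod al2)\<^sup>2)"
    unfolding d power_mult_distrib of_real_mult complex_norm_square by (simp add: mult_ac)
  then have d_real: "real_of_int d = (cmod al1 * cmod al2)\<^sup>2"
    by (metis of_real_eq_iff of_real_of_int_eq)
  moreover have "0 \<le> real_of_int d" unfolding d_real by simp
  ultimately have d1: "d = 1" by auto
  then have "(cmod al1 * cmod al2)\<^sup>2 = 1" using d_real by simp
  then have prod1: "cmod al1 * cmod al2 = 1"
    by (simp add: power2_eq_1_iff) (metis mult_nonneg_nonneg norm_ge_zero not_one_le_zero le_minus_one_simps(3))
  have ge1: "1 \<le> cmod al1"
  proof (rule ccontr)
    assume "\<not> 1 \<le> cmod al1"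
    then have "cmod al1 * cmod al2 < 1 * 1"
      using al_le by (intro mult_strict_mono') auto
    then show False using prod1 by simp
  qed
  have le1: "cmod al2 \<le> 1"
  proof (rule ccontr)
    assume "\<not> cmod al2 \<le> 1"
    then have "1 * 1 < cmod al1 * cmod al2"
      using al_le by (intro mult_strict_mono') auto
    then show False using prod1 by simp
  qed
  interpret torus_map_coords L f A l1 l2 u1 u2 al1 al2 be
  proof
    \<comment> \<open>A nonzero \<open>be\<close> requires equal eigenvalues, one of modulus at
      least 1 and the other at most 1.\<close>
    show "be = 0 \<or> cmod al1 = 1" using be ge1 le1 by auto
  qed (fact L A f_eq A_L l1 l2 coords lu lA ge1 le1)+
  have gt1: "cmod al1 > 1"
  proof (rule ccontr)
    assume "\<not> cmod al1 > 1"
    then have "cmod al1 = 1" using ge1 by simp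
    then have "top_entropy L f \<le> 0" using top_entropy_le by (simp add: zero_ereal_def)
    then show False using pos by simp
  qed
  define lam where "lam = cmod al1 ^ 2"
  have "lam > 1" unfolding lam_def using gt1 by (simp add: one_less_power)
  have al1_lam: "al1 * cnj al1 = of_real lam"
    unfolding lam_def using complex_norm_square[of al1] by simp
  have al2_lam: "al2 * cnj al2 = of_real (1 / lam)"
  proof -
    have "(al1 * cnj al1) * (al2 * cnj al2) = 1" using d d1 by (simp add: mult.assoc)
    then show ?thesis unfolding al1_lam using \<open>lam > 1\<close> by (simp add: field_simps)
  qed
  have Q: "ipoly (ext_sq_poly a b c) z = (z - of_real lam) * (z - of_real (1 / lam)) *
      ((z - al1 * al2) * (z - cnj al1 * cnj al2)) * ((z - al1 * cnj al2) * (z - cnj al1 * al2))" for z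
    unfolding al1_lam[symmetric] al2_lam[symmetric]
    by (rule ipoly_ext_sq_poly) (use abc d d1 in simp_all)
  have "complex_of_real (ipoly (ext_sq_poly a b c) lam) = 0"
    unfolding ipoly_of_real[symmetric] Q by simp
  then have "ipoly (ext_sq_poly a b c) lam = 0" unfolding of_real_eq_0_iff .
  moreover have "cmod z = 1 \<or> z = of_real lam \<or> z = of_real (1 / lam)"
    if "ipoly (ext_sq_poly a b c) z = 0" for z :: complex
  proof -
    have "z = of_real lam \<or> z = of_real (1 / lam) \<or> z = al1 * al2 \<or> z = cnj al1 * cnj al2 \<or>
        z = al1 * cnj al2 \<or> z = cnj al1 * al2"
      using that unfolding Q mult_eq_0_iff right_minus_eq by blast
    then show ?thesis using prod1 by (auto simp: norm_mult simp del: of_real_divide)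
  qed
  ultimately show ?thesis
    using that[OF \<open>lam > 1\<close>, of a b c] top_entropy_eq[OF gt1] unfolding lam_def by blast
qed

lemma torus_entropy_value_ext_sq_poly:
  assumes "torus_entropy_value (ln lam)" "lam > 1"
  obtains a b c where "ipoly (ext_sq_poly a b c) lam = 0"
    "\<And>z :: complex. ipoly (ext_sq_poly a b c) z = 0 \<Longrightarrow>
      cmod z = 1 \<or> z = of_real lam \<or> z = of_real (1 / lam)"
proof -
  obtain L f where Lf: "lattice4 L" "torus_aut L f" "top_entropy L f = ereal (ln lam)"
    using assms(1) unfolding torus_entropy_value_def by blast
  have "top_entropy L f > 0" using assms(2) Lf(3) by simp
  then obtain lam' a b c where *: "lam' > 1" "top_entropy L f = ereal (ln lam')"
    "ipoly (ext_sq_poly a b c) lam' = 0"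
    "\<And>z :: complex. ipoly (ext_sq_poly a b c) z = 0 \<Longrightarrow>
      cmod z = 1 \<or> z = of_real lam' \<or> z = of_real (1 / lam')"
    using torus_aut_entropy[OF Lf(1,2)] by blast
  have "lam' = lam" using *(1,2) Lf(3) assms(2) by simp
  then show ?thesis using that * by blast
qed

section \<open>Realizing Salem numbers\<close>

text \<open>Here \<open>y = z + 1 / z\<close>. Off the unit circle only \<open>lam\<close> and
  \<open>1 / lam\<close> occur, both with the excluded trace; on it \<open>1 / z\<close> is the
  conjugate of \<open>z\<close>, so \<open>y = 2 Re z\<close>.\<close>

lemma salem_trace_root:
  fixes y z :: complex
  assumes S: "salem lam S" and z: "z\<^sup>2 - y * z + 1 = 0" and root: "ipoly S z = 0"
    and ne: "y \<noteq> of_real (lam + 1 / lam)"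
  obtains r where "y = of_real r" "\<bar>r\<bar> \<le> 2"
proof -
  have lam: "lam > 1" using salemD(1)[OF S] .
  have z0: "z \<noteq> 0" using z by auto
  have y: "y = z + 1 / z" using z z0 by (simp add: field_simps power2_eq_square)
  have "cmod z = 1"
  proof (rule ccontr)
    assume "cmod z \<noteq> 1"
    then have "z \<in> {z. ipoly S z = 0 \<and> cmod z \<noteq> 1}" using root by simp
    then have "z = of_real lam \<or> z = of_real (1 / lam)" unfolding salemD(6)[OF S] by simp
    then have "y = of_real (lam + 1 / lam)" unfolding y using lam by auto
    then show False using ne by simp
  qed
  then have "z * cnj z = 1" using complex_norm_square[of z] by simp
  then have "1 / z = cnj z" using z0 by (simp add: field_simps)
  then have "y = of_real (2 * Re z)" unfolding y by (simp add: complex_eq_iff)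
  moreover have "\<bar>2 * Re z\<bar> \<le> 2" using abs_Re_le_cmod[of z] \<open>cmod z = 1\<close> by simp
  ultimately show ?thesis using that by blast
qed

lemma trace_quadratic_root:
  fixes y :: complex
  obtains z where "z\<^sup>2 - y * z + 1 = 0"
proof -
  obtain z w where zw: "z + w = y" "z * w = 1" by (rule complex_quadratic_roots)
  have "z\<^sup>2 - y * z + 1 = 0" unfolding zw(1)[symmetric] using zw(2) by algebra
  then show ?thesis by (rule that)
qed

lemma poly_trace_quadratic: "poly [:1, - y, 1:] z = z\<^sup>2 - y * z + (1 :: complex)"
  by (simp add: power2_eq_square algebra_simps)

lemma irreducible_trace_distinct:
  fixes y y' :: complex
  assumes "irreducible S" "map_poly of_int S = [:1, - y, 1:] * [:1, - y', 1:] * h"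
  shows "y \<noteq> y'"
proof
  assume "y = y'"
  obtain z where "z\<^sup>2 - y * z + 1 = 0" by (rule trace_quadratic_root)
  then have "poly [:1, - y, 1:] z = 0" unfolding poly_trace_quadratic .
  then show False using irreducible_separable[OF assms(1)] assms(2) \<open>y = y'\<close> by blast
qed

lemma salem_trace_factor:
  fixes y :: complex
  assumes S: "salem lam S" and fact: "map_poly of_int S = [:1, - y, 1:] * h"
    and ne: "y \<noteq> of_real (lam + 1 / lam)"
  obtains r where "y = of_real r" "\<bar>r\<bar> \<le> 2"
proof -
  obtain z where z: "z\<^sup>2 - y * z + 1 = 0" by (rule trace_quadratic_root)
  then have "ipoly S z = 0" unfolding fact poly_mult poly_trace_quadratic by simp
  then show ?thesis using salem_trace_root[OF S z _ ne] that by blast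
qed

section \<open>Solving for the quartic in degrees two, four and six\<close>

lemma salem_degree_2_entropy:
  assumes S: "salem lam S" and deg: "degree S = 2"
  shows "torus_entropy_value (ln lam)"
proof -
  obtain b where b: "S = [:1, b, 1:]"
    using palindrome_degree_2[OF salemD(5,2)[OF S] deg] by blast
  have lam: "lam > 1" using salemD(1)[OF S] .
  have "1 + of_int b * lam + lam * lam = 0"
    using salemD(4)[OF S] by (simp add: b map_poly_pCons algebra_simps)
  then have "of_int (- b) = lam + 1 / lam" using lam by (simp add: field_simps)
  \<comment> \<open>The traces 2 and -2, that is, the cofactor \<open>(x^2 - 1)^2\<close>, cancel in
    the sum, and \<open>a = c = 0\<close> satisfies the other two equations.\<close>
  then show ?thesis
    by (intro torus_entropy_value_of_traces[OF lam refl, of 2 "-2" "-b" 0 0]) auto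
qed

text \<open>\<open>S\<close> is \<open>x^2\<close> times a quadratic in \<open>x + 1 / x\<close>
  with roots \<open>lam + 1 / lam\<close> and \<open>y\<close>. An integer value \<open>r\<close> of
  \<open>y\<close> would give \<open>x^2 - r x + 1\<close> a common root with \<open>S\<close>,
  against minimality; this keeps \<open>y\<close> apart from the integer trace adjoined
  later.\<close>

lemma salem_degree_4_traces:
  assumes S: "salem lam S" and deg: "degree S = 4"
  obtains y B s where "S = [:1, B, s, B, 1:]" "lam + 1 / lam + y = - of_int B"
    "(lam + 1 / lam) * y = of_int s - 2" "\<bar>y\<bar> \<le> 2" "\<And>r :: int. y \<noteq> of_int r"
proof -
  obtain B s where Bs: "S = [:1, B, s, B, 1:]"
    using palindrome_degree_4[OF salemD(5,2)[OF S] deg] by blast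
  have lam: "lam > 1" using salemD(1)[OF S] .
  define t where "t = lam + 1 / lam"
  define y where "y = - of_int B - t"
  have tl: "t * lam = lam\<^sup>2 + 1" using lam by (simp add: t_def field_simps power2_eq_square)
  have "1 + lam * (of_int B + lam * (of_int s + lam * (of_int B + lam))) = 0"
    using salemD(4)[OF S] by (simp add: Bs map_poly_pCons)
  then have "lam\<^sup>2 * (t\<^sup>2 + of_int B * t + of_int s - 2) = 0"
    using tl by algebra
  then have t_eq: "t\<^sup>2 + of_int B * t + of_int s - 2 = 0" using lam by simp
  have ty: "t * y = of_int s - 2" unfolding y_def using t_eq by algebra
  have sum: "of_int B = - (of_real t + of_real y :: complex)"
  proof -
    have "of_int B = - (t + y)" by (simp add: y_def)
    then show ?thesis by (metis of_real_add of_real_minus of_real_of_int_eq)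
  qed
  have prod: "of_int s = of_real t * of_real y + (2 :: complex)"
  proof -
    have "of_int s = t * y + 2" using ty by simp
    then show ?thesis by (metis of_real_add of_real_mult of_real_of_int_eq of_real_numeral)
  qed
  have fact: "map_poly of_int S = [:1, - complex_of_real t, 1:] * [:1, - complex_of_real y, 1:] * 1"
    by (simp add: Bs map_poly_pCons sum prod algebra_simps)
  have ne: "complex_of_real y \<noteq> complex_of_real t"
    using irreducible_trace_distinct[OF salemD(3)[OF S] fact] by simp
  have y_fact: "map_poly of_int S = [:1, - complex_of_real y, 1:] * [:1, - complex_of_real t, 1:]"
    unfolding fact mult_1_right by (rule mult.commute)
  obtain r where "complex_of_real y = of_real r" "\<bar>r\<bar> \<le> 2"
    using salem_trace_factor[OF S y_fact] ne unfolding t_def by blast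
  then have "\<bar>y\<bar> \<le> 2" by simp
  moreover have "y \<noteq> of_int r" for r
  proof
    assume y: "y = of_int r"
    obtain z where z: "z\<^sup>2 - complex_of_real y * z + 1 = 0" by (rule trace_quadratic_root)
    then have "ipoly S z = 0" unfolding y_fact poly_mult poly_trace_quadratic by simp
    moreover have "ipoly [:1, - r, 1:] z = 0"
      using z by (simp add: y map_poly_pCons power2_eq_square algebra_simps)
    ultimately have "degree S \<le> degree [:1, - r, 1:]"
      by (intro irreducible_root_degree[OF salemD(3)[OF S]]) auto
    then show False using deg by simp
  qed
  moreover have "t + y = - of_int B" by (simp add: y_def)
  ultimately show ?thesis using that[OF Bs, of y] ty unfolding t_def by blast
qed

text \<open>The third trace is an adjoined integer \<open>r\<close>, so that
  \<open>Q = S * (x^2 - r x + 1)\<close>. The three conditions take \<open>r = -2, 2, 0\<close> in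
  this order. For \<open>r = -2\<close> the zero of \<open>Q\<close> at -1 dictates
  \<open>c = - a\<close>, and for \<open>r = 2\<close> the zero at 1 dictates
  \<open>c = a\<close>.\<close>

lemma salem_degree_4_entropy:
  assumes S: "salem lam S" and deg: "degree S = 4"
    and cond: "(\<exists>m::int. poly S 1 = - (m ^ 2)) \<or> (\<exists>n::int. poly S (-1) = (n ^ 2)) \<or>
      (\<exists>m n :: int. real_of_int (poly S 1) = - (1/2) * real_of_int m ^ 2 \<and>
        real_of_int (poly S (-1)) = (1/2) * real_of_int n ^ 2)"
  shows "torus_entropy_value (ln lam)"
proof -
  obtain y B s where Bs: "S = [:1, B, s, B, 1:]" and sum: "lam + 1 / lam + y = - of_int B"
    and prod: "(lam + 1 / lam) * y = of_int s - 2" and y: "\<bar>y\<bar> \<le> 2" "\<And>r :: int. y \<noteq> of_int r"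
    using salem_degree_4_traces[OF S deg] by blast
  have lam: "lam > 1" using salemD(1)[OF S] .
  define t where "t = lam + 1 / lam"
  note sum = sum[folded t_def] and prod = prod[folded t_def]
  have S1: "poly S 1 = 2 + 2 * B + s" and Sm1: "poly S (-1) = 2 - 2 * B + s"
    by (simp_all add: Bs)
  have realize: "torus_entropy_value (ln lam)"
    if r: "r \<in> {-2, 0, 2}" and ac: "a * c - 4 = s - 2 - r * B"
      and aacc: "a\<^sup>2 + c\<^sup>2 - 4 * (r - B) = r * (s - 2)" for r a c :: int
  proof (rule torus_entropy_value_of_traces[OF lam t_def, of y "of_int r" "r - B" a c])
    show "\<bar>real_of_int r\<bar> \<le> 2" using r by auto
    show "y \<noteq> of_int r" by (rule y(2))
    show "real_of_int (r - B) = t + y + of_int r" using sum by simp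
    have "real_of_int (a * c - 4) = of_int (s - 2 - r * B)" unfolding ac ..
    moreover have "t * y + t * of_int r + y * of_int r = of_int s - 2 - of_int r * real_of_int B"
    proof -
      have "t * y + t * of_int r + y * of_int r = t * y + of_int r * (t + y)" by (simp add: algebra_simps)
      then show ?thesis unfolding sum prod by simp
    qed
    ultimately show "real_of_int a * of_int c - 4 = t * y + t * of_int r + y * of_int r" by simp
    have "real_of_int (a\<^sup>2 + c\<^sup>2 - 4 * (r - B)) = of_int (r * (s - 2))" unfolding aacc ..
    then show "(real_of_int a)\<^sup>2 + (real_of_int c)\<^sup>2 - 4 * real_of_int (r - B) = t * y * of_int r"
      unfolding prod by (simp add: mult.commute)
  qed (fact y(1))
  from cond show ?thesis
  proof (elim disjE exE conjE)
    fix m assume "poly S 1 = - (m\<^sup>2)"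
    then show ?thesis
      using realize[of "-2" m "- m"] by (simp add: S1 power2_eq_square algebra_simps)
  next
    fix n assume "poly S (-1) = n\<^sup>2"
    then show ?thesis
      using realize[of 2 n n] by (simp add: Sm1 power2_eq_square algebra_simps)
  next
    fix m n :: int
    assume m: "real_of_int (poly S 1) = - (1/2) * real_of_int m ^ 2"
      and n: "real_of_int (poly S (-1)) = (1/2) * real_of_int n ^ 2"
    have "real_of_int (m\<^sup>2) = real_of_int (- 2 * poly S 1)" using m by simp
    then have m2: "m\<^sup>2 = - 2 * poly S 1" unfolding of_int_eq_iff .
    have "real_of_int (n\<^sup>2) = real_of_int (2 * poly S (-1))" using n by simp
    then have n2: "n\<^sup>2 = 2 * poly S (-1)" unfolding of_int_eq_iff .
    \<comment> \<open>Halving \<open>m\<close> and \<open>n\<close> makes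
      \<open>a = (m + n) / 2\<close> and \<open>c = (n - m) / 2\<close> integers.\<close>
    have "even (m\<^sup>2)" "even (n\<^sup>2)" unfolding m2 n2 by simp_all
    then obtain m' n' where mn: "m = 2 * m'" "n = 2 * n'" by (auto elim!: evenE)
    have "4 * m'\<^sup>2 = - 2 * (2 + 2 * B + s)" "4 * n'\<^sup>2 = 2 * (2 - 2 * B + s)"
      using m2 n2 unfolding S1 Sm1 mn by (simp_all add: power_mult_distrib)
    then have "n'\<^sup>2 - m'\<^sup>2 = s + 2" and "m'\<^sup>2 + n'\<^sup>2 = - 2 * B"
      by (simp_all add: algebra_simps)
    then show ?thesis
      using realize[of 0 "m' + n'" "n' - m'"] by (simp add: power2_eq_square algebra_simps)
  qed
qed

text \<open>\<open>S\<close> is \<open>x^3\<close> times a cubic in \<open>x + 1 / x\<close> with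
  the root \<open>lam + 1 / lam\<close>. The quotient by this root supplies \<open>y2\<close> and
  \<open>y3\<close> as complex numbers; the Salem property makes them real and bounds them.\<close>

lemma salem_degree_6_traces:
  assumes S: "salem lam S" and deg: "degree S = 6"
  obtains t2 t3 B s k where "S = [:1, B, s, k, s, B, 1:]"
    "lam + 1 / lam + t2 + t3 = - of_int B"
    "(lam + 1 / lam) * t2 + (lam + 1 / lam) * t3 + t2 * t3 = of_int s - 3"
    "(lam + 1 / lam) * t2 * t3 = 2 * of_int B - of_int k"
    "\<bar>t2\<bar> \<le> 2" "\<bar>t3\<bar> \<le> 2" "t2 \<noteq> t3"
proof -
  obtain B s k where Bs: "S = [:1, B, s, k, s, B, 1:]"
    using palindrome_degree_6[OF salemD(5,2)[OF S] deg] by blast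
  have lam: "lam > 1" using salemD(1)[OF S] .
  define t where "t = lam + 1 / lam"
  have tl: "t * lam = lam\<^sup>2 + 1" using lam by (simp add: t_def field_simps power2_eq_square)
  have "1 + lam * (of_int B + lam * (of_int s + lam * (of_int k + lam * (of_int s + lam * (of_int B + lam))))) = 0"
    using salemD(4)[OF S] by (simp add: Bs map_poly_pCons)
  then have "lam ^ 3 * (t ^ 3 + of_int B * t\<^sup>2 + (of_int s - 3) * t + of_int k - 2 * of_int B) = 0"
    using tl by algebra
  then have "t ^ 3 + of_int B * t\<^sup>2 + (of_int s - 3) * t + of_int k - 2 * of_int B = 0" using lam by simp
  then have "complex_of_real (t ^ 3 + of_int B * t\<^sup>2 + (of_int s - 3) * t + of_int k - 2 * of_int B) = of_real 0"
    by (rule arg_cong)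
  then have T: "of_real t ^ 3 + of_int B * (of_real t)\<^sup>2 + (of_int s - 3) * of_real t + of_int k - 2 * of_int B = (0 :: complex)"
    by simp
  obtain y2 y3 :: complex where y: "y2 + y3 = - of_int B - of_real t"
    "y2 * y3 = (of_real t)\<^sup>2 + of_int B * of_real t + of_int s - 3"
    by (rule complex_quadratic_roots)
  have e1: "of_int B = - (of_real t + y2 + y3)" using y(1) by algebra
  have e2: "of_int s = of_real t * y2 + of_real t * y3 + y2 * y3 + 3"
    using y by algebra
  have e3: "of_int k = 2 * of_int B - of_real t * y2 * y3"
    using T y by algebra
  let ?g = "\<lambda>y. [:1, - y, 1 :: complex:]"
  have fact: "map_poly of_int S = ?g (of_real t) * ?g y2 * ?g y3"
    by (simp add: Bs map_poly_pCons e3 e2 e1 algebra_simps)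
  \<comment> \<open>The factors are permuted so that each pair, and each of the two new traces,
    stands in front once.\<close>
  have fact2: "map_poly of_int S = ?g (of_real t) * ?g y3 * ?g y2"
    and fact3: "map_poly of_int S = ?g y2 * ?g y3 * ?g (of_real t)"
    unfolding fact by (simp_all only: mult_ac)
  have fact4: "map_poly of_int S = ?g y2 * (?g y3 * ?g (of_real t))"
    and fact5: "map_poly of_int S = ?g y3 * (?g y2 * ?g (of_real t))"
    unfolding fact by (simp_all only: mult_ac)
  note distinct = irreducible_trace_distinct[OF salemD(3)[OF S]]
  have "y2 \<noteq> of_real t" "y3 \<noteq> of_real t" "y2 \<noteq> y3"
    using distinct[OF fact] distinct[OF fact2] distinct[OF fact3] by simp_all
  obtain t2 where t2: "y2 = of_real t2" "\<bar>t2\<bar> \<le> 2"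
    using salem_trace_factor[OF S fact4] \<open>y2 \<noteq> of_real t\<close> unfolding t_def by blast
  obtain t3 where t3: "y3 = of_real t3" "\<bar>t3\<bar> \<le> 2"
    using salem_trace_factor[OF S fact5] \<open>y3 \<noteq> of_real t\<close> unfolding t_def by blast
  have "t2 \<noteq> t3" using \<open>y2 \<noteq> y3\<close> t2 t3 by auto
  have "complex_of_real (t + t2 + t3) = of_real (- of_int B)"
    using e1 t2 t3 by simp
  then have r1: "t + t2 + t3 = - of_int B" unfolding of_real_eq_iff .
  have "complex_of_real (t * t2 + t * t3 + t2 * t3) = of_real (of_int s - 3)"
    using e2 t2 t3 by simp
  then have r2: "t * t2 + t * t3 + t2 * t3 = of_int s - 3" unfolding of_real_eq_iff .
  have "complex_of_real (t * t2 * t3) = of_real (2 * of_int B - of_int k)"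
    using e3 t2 t3 by simp
  then have r3: "t * t2 * t3 = 2 * of_int B - of_int k" unfolding of_real_eq_iff .
  show ?thesis
    by (rule that[OF Bs r1[unfolded t_def] r2[unfolded t_def] r3[unfolded t_def] t2(2) t3(2) \<open>t2 \<noteq> t3\<close>])
qed

text \<open>Here \<open>Q = S\<close>, so \<open>a - c = m\<close> and \<open>a + c = n\<close> must
  be solved in integers. The parity condition holds because \<open>S(1)\<close> and
  \<open>S(-1)\<close> are congruent modulo 2.\<close>

lemma salem_degree_6_entropy:
  assumes S: "salem lam S" and deg: "degree S = 6"
    and m: "poly S 1 = - (m\<^sup>2)" and n: "poly S (-1) = n\<^sup>2"
  shows "torus_entropy_value (ln lam)"
proof -
  obtain t2 t3 B s k where Bs: "S = [:1, B, s, k, s, B, 1:]"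
    and r: "lam + 1 / lam + t2 + t3 = - of_int B"
      "(lam + 1 / lam) * t2 + (lam + 1 / lam) * t3 + t2 * t3 = of_int s - 3"
      "(lam + 1 / lam) * t2 * t3 = 2 * of_int B - of_int k"
    and t23: "\<bar>t2\<bar> \<le> 2" "\<bar>t3\<bar> \<le> 2" "t2 \<noteq> t3"
    by (rule salem_degree_6_traces[OF S deg])
  have lam: "lam > 1" using salemD(1)[OF S] .
  have m2: "m\<^sup>2 = - (2 + 2 * B + 2 * s + k)" using m by (simp add: Bs)
  have n2: "n\<^sup>2 = 2 - 2 * B + 2 * s - k" using n by (simp add: Bs)
  have "even (m\<^sup>2 + n\<^sup>2)" unfolding m2 n2 by simp
  then have "even (m + n)" by simp
  then obtain a where a: "m + n = 2 * a" by (rule evenE)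
  define c where "c = n - a"
  have mn: "m = a - c" "n = a + c" using a by (simp_all add: c_def)
  have "4 * (a * c) = n\<^sup>2 - m\<^sup>2" unfolding mn by (simp add: power2_eq_square algebra_simps)
  then have ac: "a * c = s + 1" unfolding m2 n2 by simp
  have "2 * (a\<^sup>2 + c\<^sup>2) = n\<^sup>2 + m\<^sup>2" unfolding mn by (simp add: power2_eq_square algebra_simps)
  then have aacc: "a\<^sup>2 + c\<^sup>2 = - 2 * B - k" unfolding m2 n2 by simp
  show ?thesis
  proof (rule torus_entropy_value_of_traces[OF lam refl t23, of "- B" a c])
    have "real_of_int (a * c) = of_int (s + 1)" unfolding ac ..
    then show "real_of_int a * of_int c - 4 = (lam + 1 / lam) * t2 + (lam + 1 / lam) * t3 + t2 * t3"
      unfolding r by simp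
    have "real_of_int (a\<^sup>2 + c\<^sup>2) = of_int (- 2 * B - k)" unfolding aacc ..
    then show "(real_of_int a)\<^sup>2 + (real_of_int c)\<^sup>2 - 4 * real_of_int (- B) = (lam + 1 / lam) * t2 * t3"
      unfolding r by simp
  qed (use r(1) in simp)
qed

theorem theorem1p1:
  shows "(\<forall>lam S. salem lam S \<longrightarrow>
      (degree S = 6 \<longrightarrow>
         (torus_entropy_value (ln lam) \<longleftrightarrow>
            (\<exists>m::int. poly S 1 = - (m ^ 2)) \<and> (\<exists>n::int. poly S (-1) = (n ^ 2)))) \<and>
      (degree S = 4 \<longrightarrow>
         (torus_entropy_value (ln lam) \<longleftrightarrow>
            (\<exists>m::int. poly S 1 = - (m ^ 2)) \<or> (\<exists>n::int. poly S (-1) = (n ^ 2)) \<or>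
            (\<exists>m n :: int. real_of_int (poly S 1) = - (1/2) * real_of_int m ^ 2 \<and>
                          real_of_int (poly S (-1)) = (1/2) * real_of_int n ^ 2))) \<and>
      (degree S = 2 \<longrightarrow> torus_entropy_value (ln lam)))
   \<and> (\<forall>L f. lattice4 L \<and> torus_aut L f \<and> top_entropy L f > 0 \<longrightarrow>
       (\<exists>lam S. salem lam S \<and> degree S \<in> {2, 4, 6} \<and> top_entropy L f = ereal (ln lam)))"
proof (rule conjI)
  show "\<forall>lam S. salem lam S \<longrightarrow>
      (degree S = 6 \<longrightarrow>
         (torus_entropy_value (ln lam) \<longleftrightarrow>
            (\<exists>m::int. poly S 1 = - (m ^ 2)) \<and> (\<exists>n::int. poly S (-1) = (n ^ 2)))) \<and>
      (degree S = 4 \<longrightarrow>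
         (torus_entropy_value (ln lam) \<longleftrightarrow>
            (\<exists>m::int. poly S 1 = - (m ^ 2)) \<or> (\<exists>n::int. poly S (-1) = (n ^ 2)) \<or>
            (\<exists>m n :: int. real_of_int (poly S 1) = - (1/2) * real_of_int m ^ 2 \<and>
                          real_of_int (poly S (-1)) = (1/2) * real_of_int n ^ 2))) \<and>
      (degree S = 2 \<longrightarrow> torus_entropy_value (ln lam))"
  proof (intro allI impI conjI)
    fix lam :: real and S :: "int poly"
    assume S: "salem lam S" and deg: "degree S = 6"
    show "torus_entropy_value (ln lam) \<longleftrightarrow>
      (\<exists>m::int. poly S 1 = - (m ^ 2)) \<and> (\<exists>n::int. poly S (-1) = (n ^ 2))"
    proof
      assume "torus_entropy_value (ln lam)"
      then obtain a b c where "ipoly (ext_sq_poly a b c) lam = 0"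
        using torus_entropy_value_ext_sq_poly[OF _ salemD(1)[OF S]] by blast
      then have "S = ext_sq_poly a b c" by (rule salem_entropy_degree_6[OF S deg])
      then show "(\<exists>m::int. poly S 1 = - (m ^ 2)) \<and> (\<exists>n::int. poly S (-1) = (n ^ 2))"
        using poly_ext_sq_poly_1 poly_ext_sq_poly_minus_1 by blast
    qed (use salem_degree_6_entropy[OF S deg] in blast)
  next
    fix lam :: real and S :: "int poly"
    assume S: "salem lam S" and deg: "degree S = 4"
    show "torus_entropy_value (ln lam) \<longleftrightarrow>
            (\<exists>m::int. poly S 1 = - (m ^ 2)) \<or> (\<exists>n::int. poly S (-1) = (n ^ 2)) \<or>
            (\<exists>m n :: int. real_of_int (poly S 1) = - (1/2) * real_of_int m ^ 2 \<and>
                          real_of_int (poly S (-1)) = (1/2) * real_of_int n ^ 2)"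
      (is "_ \<longleftrightarrow> ?C")
    proof
      assume "torus_entropy_value (ln lam)"
      then obtain a b c where "ipoly (ext_sq_poly a b c) lam = 0"
        "\<And>z :: complex. ipoly (ext_sq_poly a b c) z = 0 \<Longrightarrow>
          cmod z = 1 \<or> z = of_real lam \<or> z = of_real (1 / lam)"
        using torus_entropy_value_ext_sq_poly[OF _ salemD(1)[OF S]] by blast
      then show ?C by (rule salem_entropy_necessary_4[OF S deg])
    next
      assume ?C
      then show "torus_entropy_value (ln lam)" by (rule salem_degree_4_entropy[OF S deg])
    qed
  qed (rule salem_degree_2_entropy)
  show "\<forall>L f. lattice4 L \<and> torus_aut L f \<and> top_entropy L f > 0 \<longrightarrow>
       (\<exists>lam S. salem lam S \<and> degree S \<in> {2, 4, 6} \<and> top_entropy L f = ereal (ln lam))"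
  proof (intro allI impI, elim conjE)
    fix L f assume Lf: "lattice4 L" "torus_aut L f" "top_entropy L f > 0"
    obtain lam a b c where lam: "lam > 1" "top_entropy L f = ereal (ln lam)"
      and Q: "ipoly (ext_sq_poly a b c) lam = 0"
      and roots: "\<And>z :: complex. ipoly (ext_sq_poly a b c) z = 0 \<Longrightarrow>
        cmod z = 1 \<or> z = of_real lam \<or> z = of_real (1 / lam)"
      using torus_aut_entropy[OF Lf] by blast
    obtain S where "salem lam S" "degree S \<in> {2, 4, 6}"
      using exists_salem[OF lam(1) Q roots] by blast
    then show "\<exists>lam S. salem lam S \<and> degree S \<in> {2, 4, 6} \<and> top_entropy L f = ereal (ln lam)"
      using lam(2) by blast
  qed
qed

end
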